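(* Let $\gamma>0$, let $\mathcal{W}_\gamma=\{\boldsymbol{w}\in\mathbb{R}^{N_w}\mid \|\boldsymbol{w}\|_2\le\gamma\}$, let $\mathcal{U}\subseteq\mathbb{R}^{N_u}$ be a closed convex set, and let $x_0\in\mathbb{R}^{n_x}$. With $J,\boldsymbol{a},\boldsymbol{A},\boldsymbol{b},\boldsymbol{B},\boldsymbol{c},\boldsymbol{C},\boldsymbol{D}$ and $\mathcal{Q}$ as in the context, consider the robust control problem $$\min_{\boldsymbol{u}\in\mathcal{U}}\ \max_{\boldsymbol{w}\in\mathcal{W}_\gamma} J(x_0,\boldsymbol{u},\boldsymbol{w}).\qquad (\mathrm{P})$$ There exists a nonsingular matrix $S\in\mathbb{R}^{N_w\times N_w}$ with $S^TS=\operatorname{diag}(\sigma_1,\dots,\sigma_{N_w})$ and $S^T\boldsymbol{C}S=\operatorname{diag}(\tau_1,\dots,\tau_{N_w})$. For any such $S$, problem $(\mathrm{P})$ is equivalent to $$\begin{array}{ll}\underset{(\boldsymbol{u},\lambda,t)\in\mathbb{R}^{N_u}\times\mathbb{R}\times\mathbb{R}^{N_w}}{\text{minimize}} & \boldsymbol{u}^T\boldsymbol{B}\boldsymbol{u}+2\boldsymbol{b}^T\boldsymbol{u}+\boldsymbol{1}^Tt+\gamma^2\lambda\\ \text{subject to} & \boldsymbol{u}\in\mathcal{U},\quad \lambda\ge 0,\\ & \big([S^T(\boldsymbol{c}+\boldsymbol{D}^T\boldsymbol{u})]_i,\ t_i,\ \lambda\sigma_i-\tau_i\big)\in\mathcal{Q},\quad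 i=1,\dots,N_w,\end{array}\qquad(\mathrm{R})$$ in the following sense: the optimal value of $(\mathrm{P})$ equals the optimal value of $(\mathrm{R})$ plus the constant $2\boldsymbol{a}^Tx_0+x_0^T\boldsymbol{A}x_0$, and $\boldsymbol{u}^\star$ is optimal for $(\mathrm{P})$ if and only if there is $(\lambda,t)$ such that $(\boldsymbol{u}^\star,\lambda,t)$ is optimal for $(\mathrm{R})$. In particular, if $\mathcal{U}$ is polyhedral or, more generally, second-order-cone representable, then $(\mathrm{P})$ can be reformulated exactly as a second-order cone program.
   Context: System: $x_{k+1}=A_kx_k+B_ku_k+C_kw_k$, $k=0,\dots,N-1$, with $x_k\in\mathbb{R}^{n_x}$, $u_k\in\mathbb{R}^{n_u}$, $w_k\in\mathbb{R}^{n_w}$, real matrices $A_k,B_k,C_k$ of matching sizes, and horizon $N\ge1$. Put $\boldsymbol{u}=(u_0,\dots,u_{N-1})\in\mathbb{R}^{N_u}$, $\boldsymbol{w}=(w_0,\dots,w_{N-1})\in\mathbb{R}^{N_w}$, $N_u=Nn_u$, $N_w=Nn_w$. Cost: $$J(x_0,\boldsymbol{u},\boldsymbol{w})=\sum_{k=1}^N(x_k^TQ_kx_k+2q_k^Tx_k)+\sum_{k=0}^{N-1}(u_k^TR_ku_k+2r_k^Tu_k),$$ with $Q_k$ symmetric positive semidefinite and $R_k$ symmetric positive definite, $q_k\in\mathbb{R}^{n_x}$, $r_k\in\mathbb{R}^{n_u}$. Compact form: the stacked state $(x_1,\dots,x_N)$ is linear in the data, $(x_1,\dots,x_N)=\mathscr{A}x_0+\mathscr{B}\boldsymbol{u}+\mathscr{C}\boldsymbol{w}$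 for matrices $\mathscr{A},\mathscr{B},\mathscr{C}$ determined by the dynamics. With $\bar Q=\operatorname{blkdiag}(Q_1,\dots,Q_N)$, $\bar R=\operatorname{blkdiag}(R_0,\dots,R_{N-1})$, $\bar q=(q_1,\dots,q_N)$, $\bar r=(r_0,\dots,r_{N-1})$, set $\boldsymbol{A}=\mathscr{A}^T\bar Q\mathscr{A}$, $\boldsymbol{a}=\mathscr{A}^T\bar q$, $\boldsymbol{B}=\mathscr{B}^T\bar Q\mathscr{B}+\bar R\succ0$, $\boldsymbol{b}=\bar r+\mathscr{B}^T(\bar q+\bar Q\mathscr{A}x_0)$, $\boldsymbol{C}=\mathscr{C}^T\bar Q\mathscr{C}$, $\boldsymbol{c}=\mathscr{C}^T(\bar q+\bar Q\mathscr{A}x_0)$, $\boldsymbol{D}=\mathscr{B}^T\bar Q\mathscr{C}$. Then $$J(x_0,\boldsymbol{u},\boldsymbol{w})=\boldsymbol{w}^T\boldsymbol{C}\boldsymbol{w}+2(\boldsymbol{c}+\boldsymbol{D}^T\boldsymbol{u})^T\boldsymbol{w}+\boldsymbol{u}^T\boldsymbol{B}\boldsymbol{u}+2\boldsymbol{b}^T\boldsymbol{u}+2\boldsymbol{a}^Tx_0+x_0^T\boldsymbol{A}x_0.$$ $\mathcal{Q}=\{(x,y,z)\in\mathbb{R}^3\mid \|(2x,\,y-z)\|_2\le y+z\}$. $\boldsymbol{1}$ is the all-ones vector and $[v]_i$ the $i$-th component of $v$. A second-order cone program (SOCP) is a problem: minimize $f^Tx$ subject to finitely many constraints $\|A_ix+b_i\|_2\le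 c_i^Tx+d_i$ and $Fx=g$. A set is second-order-cone representable if it is the projection onto some of the coordinates of the feasible set of such a finite system of constraints. *)

theory Defs
  imports "HOL-Analysis.Analysis"
begin

section \<open>The linear-quadratic system\<close>

text \<open>
  The horizon is \<open>N = CARD('t)\<close> for a finite linearly ordered type \<open>'t\<close> of stages, so that
  the stacked vectors live in \<open>real^('t \<times> 'u)\<close> etc.  The stage data are sequences indexed by
  natural numbers as in the dynamics; only \<open>dyn_A P k\<close>, \<open>dyn_B P k\<close>, \<open>dyn_C P k\<close>,
  \<open>cost_R P k\<close>, \<open>cost_r P k\<close> for \<open>k < N\<close> and \<open>cost_Q P k\<close>, \<open>cost_q P k\<close> for
  \<open>1 \<le> k \<le> N\<close> are ever used.
\<close>

record ('x, 'u, 'w) lq_system =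
  dyn_A :: "nat \<Rightarrow> real^'x^'x"
  dyn_B :: "nat \<Rightarrow> real^'u^'x"
  dyn_C :: "nat \<Rightarrow> real^'w^'x"
  cost_Q :: "nat \<Rightarrow> real^'x^'x"
  cost_q :: "nat \<Rightarrow> real^'x"
  cost_R :: "nat \<Rightarrow> real^'u^'u"
  cost_r :: "nat \<Rightarrow> real^'u"

definition sym_pos_semidef :: "real^'n^'n \<Rightarrow> bool" where
  "sym_pos_semidef M \<longleftrightarrow> transpose M = M \<and> (\<forall>x. 0 \<le> x \<bullet> (M *v x))"

definition sym_pos_def :: "real^'n^'n \<Rightarrow> bool" where
  "sym_pos_def M \<longleftrightarrow> transpose M = M \<and> (\<forall>x. x \<noteq> 0 \<longrightarrow> 0 < x \<bullet> (M *v x))"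

definition stage :: "'t::{finite,linorder} \<Rightarrow> nat" where
  "stage i = card {..<i}"

lemma stage_less: "stage (i::'t::{finite,linorder}) < CARD('t)"
  unfolding stage_def by (rule psubset_card_mono) auto

lemma stage_strict_mono: "i < j \<Longrightarrow> stage i < stage (j::'t::{finite,linorder})"
  unfolding stage_def by (rule psubset_card_mono) auto

lemma inj_stage: "inj (stage :: 't::{finite,linorder} \<Rightarrow> nat)"
proof (rule injI)
  fix i j :: 't assume "stage i = stage j"
  then show "i = j"
    using stage_strict_mono[of i j] stage_strict_mono[of j i] by (cases i j rule: linorder_cases) auto
qed

lemma bij_betw_stage: "bij_betw stage (UNIV :: 't::{finite,linorder} set) {..<CARD('t)}"
proof -
  have "range (stage :: 't \<Rightarrow> nat) \<subseteq> {..<CARD('t)}"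
    using stage_less by auto
  moreover have "card (range (stage :: 't \<Rightarrow> nat)) = CARD('t)"
    by (simp add: card_image inj_stage)
  ultimately have "range (stage :: 't \<Rightarrow> nat) = {..<CARD('t)}"
    by (simp add: card_subset_eq)
  then show ?thesis
    by (simp add: bij_betw_def inj_stage)
qed

lemma inv_stage [simp]: "inv stage (stage (i::'t::{finite,linorder})) = i"
  by (simp add: inj_stage)

lemma stage_inv: "k < CARD('t) \<Longrightarrow> stage (inv stage k :: 't::{finite,linorder}) = k"
  by (metis bij_betw_stage bij_betw_imp_surj_on f_inv_into_f lessThan_iff)

definition block :: "real^('t::{finite,linorder} \<times> 'n::finite) \<Rightarrow> nat \<Rightarrow> real^'n" where
  "block v k = (\<chi> i. v $ (inv stage k, i))"

definition stacked :: "(nat \<Rightarrow> real^'n) \<Rightarrow> real^('t::{finite,linorder} \<times> 'n::finite)" where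
  "stacked f = (\<chi> p. f (stage (fst p)) $ snd p)"

definition blkdiag :: "(nat \<Rightarrow> real^'n^'n) \<Rightarrow>
    real^('t::{finite,linorder} \<times> 'n::finite)^('t \<times> 'n)" where
  "blkdiag M = (\<chi> p p'. if fst p = fst p' then M (stage (fst p)) $ snd p $ snd p' else 0)"

primrec trajectory :: "('x::finite,'u::finite,'w::finite) lq_system \<Rightarrow> real^'x \<Rightarrow>
    (nat \<Rightarrow> real^'u) \<Rightarrow> (nat \<Rightarrow> real^'w) \<Rightarrow> nat \<Rightarrow> real^'x" where
  "trajectory P x0 u w 0 = x0"
| "trajectory P x0 u w (Suc k) =
    dyn_A P k *v trajectory P x0 u w k + dyn_B P k *v u k + dyn_C P k *v w k"

definition cost_J :: "('x::finite,'u::finite,'w::finite) lq_system \<Rightarrow> real^'x \<Rightarrow>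
    real^('t::{finite,linorder} \<times> 'u) \<Rightarrow> real^('t \<times> 'w) \<Rightarrow> real" where
  "cost_J P x0 u w =
     (let x = trajectory P x0 (block u) (block w) in
      (\<Sum>k=1..CARD('t). x k \<bullet> (cost_Q P k *v x k) + 2 * (cost_q P k \<bullet> x k)) +
      (\<Sum>k<CARD('t). block u k \<bullet> (cost_R P k *v block u k) + 2 * (cost_r P k \<bullet> block u k)))"


section \<open>Compact form\<close>

definition stacked_state :: "('x::finite,'u::finite,'w::finite) lq_system \<Rightarrow> real^'x \<Rightarrow>
    real^('t::{finite,linorder} \<times> 'u) \<Rightarrow> real^('t \<times> 'w) \<Rightarrow> real^('t \<times> 'x)" where
  "stacked_state P x0 u w = stacked (\<lambda>k. trajectory P x0 (block u) (block w) (Suc k))"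

text \<open>The matrices of the three linear parts of the stacked state; see \<open>stacked_state_linear\<close>.\<close>

definition scrA :: "('x::finite,'u::finite,'w::finite) lq_system \<Rightarrow> real^'x^('t::{finite,linorder} \<times> 'x)" where
  "scrA P = matrix (\<lambda>x0. stacked_state P x0 0 0)"

definition scrB :: "('x::finite,'u::finite,'w::finite) lq_system \<Rightarrow> real^('t \<times> 'u)^('t::{finite,linorder} \<times> 'x)" where
  "scrB P = matrix (\<lambda>u. stacked_state P 0 u 0)"

definition scrC :: "('x::finite,'u::finite,'w::finite) lq_system \<Rightarrow> real^('t \<times> 'w)^('t::{finite,linorder} \<times> 'x)" where
  "scrC P = matrix (\<lambda>w. stacked_state P 0 0 w)"

definition Qbar :: "('x::finite,'u::finite,'w::finite) lq_system \<Rightarrow> real^('t::{finite,linorder} \<times> 'x)^('t \<times> 'x)" where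
  "Qbar P = blkdiag (\<lambda>k. cost_Q P (Suc k))"

definition Rbar :: "('x::finite,'u::finite,'w::finite) lq_system \<Rightarrow> real^('t::{finite,linorder} \<times> 'u)^('t \<times> 'u)" where
  "Rbar P = blkdiag (cost_R P)"

definition qbar :: "('x::finite,'u::finite,'w::finite) lq_system \<Rightarrow> real^('t::{finite,linorder} \<times> 'x)" where
  "qbar P = stacked (\<lambda>k. cost_q P (Suc k))"

definition rbar :: "('x::finite,'u::finite,'w::finite) lq_system \<Rightarrow> real^('t::{finite,linorder} \<times> 'u)" where
  "rbar P = stacked (cost_r P)"

text \<open>
  The types of \<open>bigA\<close> and \<open>vec_a\<close> do not mention the horizon, so it is passed as \<open>TYPE('t)\<close>.
\<close>

definition bigA :: "'t::{finite,linorder} itself \<Rightarrow> ('x::finite,'u::finite,'w::finite) lq_system \<Rightarrow> real^'x^'x" where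
  "bigA _ P = transpose (scrA P :: real^'x^('t \<times> 'x)) ** Qbar P ** scrA P"

definition vec_a :: "'t::{finite,linorder} itself \<Rightarrow> ('x::finite,'u::finite,'w::finite) lq_system \<Rightarrow> real^'x" where
  "vec_a _ P = transpose (scrA P :: real^'x^('t \<times> 'x)) *v qbar P"

definition bigB :: "('x::finite,'u::finite,'w::finite) lq_system \<Rightarrow> real^('t::{finite,linorder} \<times> 'u)^('t \<times> 'u)" where
  "bigB P = transpose (scrB P) ** Qbar P ** scrB P + Rbar P"

definition vec_b :: "('x::finite,'u::finite,'w::finite) lq_system \<Rightarrow> real^'x \<Rightarrow> real^('t::{finite,linorder} \<times> 'u)" where
  "vec_b P x0 = rbar P + transpose (scrB P) *v (qbar P + Qbar P *v (scrA P *v x0))"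

definition bigC :: "('x::finite,'u::finite,'w::finite) lq_system \<Rightarrow> real^('t::{finite,linorder} \<times> 'w)^('t \<times> 'w)" where
  "bigC P = transpose (scrC P) ** Qbar P ** scrC P"

definition vec_c :: "('x::finite,'u::finite,'w::finite) lq_system \<Rightarrow> real^'x \<Rightarrow> real^('t::{finite,linorder} \<times> 'w)" where
  "vec_c P x0 = transpose (scrC P) *v (qbar P + Qbar P *v (scrA P *v x0))"

definition bigD :: "('x::finite,'u::finite,'w::finite) lq_system \<Rightarrow> real^('t::{finite,linorder} \<times> 'w)^('t \<times> 'u)" where
  "bigD P = transpose (scrB P) ** Qbar P ** scrC P"

lemma block_add: "block (u + v) k = block u k + block v k"
  by (simp add: block_def vec_eq_iff)

lemma block_scaleR: "block (c *\<^sub>R u) k = c *\<^sub>R block u k"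
  by (simp add: block_def vec_eq_iff)

lemma block_0 [simp]: "block 0 k = 0"
  by (simp add: block_def vec_eq_iff)

lemma block_stacked: "k < CARD('t) \<Longrightarrow>
    block (stacked f :: real^('t::{finite,linorder} \<times> 'n::finite)) k = f k"
  by (simp add: block_def stacked_def vec_eq_iff stage_inv)

lemma trajectory_add:
  "trajectory P (x + x') (\<lambda>k. u k + u' k) (\<lambda>k. w k + w' k) k =
   trajectory P x u w k + trajectory P x' u' w' k"
  by (induction k) (simp_all add: matrix_vector_right_distrib algebra_simps)

lemma trajectory_scaleR:
  "trajectory P (c *\<^sub>R x) (\<lambda>k. c *\<^sub>R u k) (\<lambda>k. c *\<^sub>R w k) k = c *\<^sub>R trajectory P x u w k"
  by (induction k) (simp_all add: matrix_vector_mult_scaleR algebra_simps)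

lemma stacked_state_add:
  "stacked_state P (x + x') (u + u') (w + w') = stacked_state P x u w + stacked_state P x' u' w'"
  by (simp add: stacked_state_def stacked_def vec_eq_iff block_add[abs_def] trajectory_add
      del: trajectory.simps)

lemma stacked_state_scaleR:
  "stacked_state P (c *\<^sub>R x) (c *\<^sub>R u) (c *\<^sub>R w) = c *\<^sub>R stacked_state P x u w"
  by (simp add: stacked_state_def stacked_def vec_eq_iff block_scaleR[abs_def] trajectory_scaleR
      del: trajectory.simps)

lemma stacked_state_linear:
  fixes u :: "real^('t::{finite,linorder} \<times> 'u::finite)"
  shows "stacked_state P x0 u w = scrA P *v x0 + scrB P *v u + scrC P *v w"
proof -
  have A: "linear (\<lambda>x0. stacked_state P x0 (0::real^('t \<times> 'u)) 0)"
    using stacked_state_add[of P _ _ "0::real^('t \<times> 'u)" 0 0 0]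
      stacked_state_scaleR[of P _ _ "0::real^('t \<times> 'u)" 0]
    by (intro linearI) auto
  have B: "linear (\<lambda>u::real^('t \<times> 'u). stacked_state P 0 u 0)"
    using stacked_state_add[of P 0 0 _ _ 0 0] stacked_state_scaleR[of P _ 0 _ 0]
    by (intro linearI) auto
  have C: "linear (\<lambda>w. stacked_state P 0 (0::real^('t \<times> 'u)) w)"
    using stacked_state_add[of P 0 0 "0::real^('t \<times> 'u)" 0]
      stacked_state_scaleR[of P _ 0 "0::real^('t \<times> 'u)"]
    by (intro linearI) auto
  have "stacked_state P x0 u w =
      stacked_state P x0 (0::real^('t \<times> 'u)) 0 + stacked_state P 0 u 0 + stacked_state P 0 0 w"
    using stacked_state_add[of P x0 0 0 u 0 0] stacked_state_add[of P x0 0 u 0 0 w] by simp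
  then show ?thesis
    by (simp add: scrA_def scrB_def scrC_def matrix_works A B C)
qed

lemma inner_stacked:
  fixes v :: "real^('t::{finite,linorder} \<times> 'n::finite)"
  shows "v \<bullet> v' = (\<Sum>k<CARD('t). block v k \<bullet> block v' k)"
proof -
  have "v \<bullet> v' = (\<Sum>i\<in>(UNIV::'t set). \<Sum>j\<in>UNIV. v $ (i,j) * v' $ (i,j))"
    by (simp add: inner_vec_def sum.cartesian_product)
  also have "\<dots> = (\<Sum>i\<in>(UNIV::'t set). block v (stage i) \<bullet> block v' (stage i))"
    by (simp add: inner_vec_def block_def)
  also have "\<dots> = (\<Sum>k<CARD('t). block v k \<bullet> block v' k)"
    by (rule sum.reindex_bij_betw[OF bij_betw_stage])
  finally show ?thesis .
qed

lemma block_blkdiag: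
  fixes v :: "real^('t::{finite,linorder} \<times> 'n::finite)"
  assumes "k < CARD('t)"
  shows "block (blkdiag M *v v) k = M k *v block v k"
proof -
  have "(blkdiag M *v v) $ (inv stage k, i) = (M k *v block v k) $ i" for i
  proof -
    let ?s = "inv stage k :: 't"
    have "(blkdiag M *v v) $ (?s, i) =
        (\<Sum>t\<in>UNIV. \<Sum>j\<in>UNIV. (if ?s = t then M (stage ?s) $ i $ j else 0) * v $ (t, j))"
      unfolding matrix_vector_mult_def blkdiag_def sum.cartesian_product UNIV_Times_UNIV
      by (simp add: case_prod_unfold cong: if_cong)
    also have "\<dots> = (\<Sum>t\<in>UNIV. if ?s = t then \<Sum>j\<in>UNIV. M (stage ?s) $ i $ j * v $ (t, j) else 0)"
      by (intro sum.cong) auto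
    also have "\<dots> = (M k *v block v k) $ i"
      by (simp add: matrix_vector_mult_def block_def stage_inv[OF assms])
    finally show ?thesis .
  qed
  then show ?thesis
    by (simp add: block_def vec_eq_iff)
qed

lemma transpose_blkdiag:
  assumes "\<And>k. k < CARD('t) \<Longrightarrow> transpose (M k) = M k"
  shows "transpose (blkdiag M :: real^('t::{finite,linorder} \<times> 'n::finite)^('t \<times> 'n)) = blkdiag M"
proof -
  have "M (stage i) $ a $ b = M (stage i) $ b $ a" for i :: 't and a b
    using arg_cong[OF assms[OF stage_less[of i]], of "\<lambda>A. A $ b $ a"] by (simp add: transpose_def)
  then show ?thesis
    by (auto simp: blkdiag_def transpose_def vec_eq_iff)
qed

lemma cost_J_stacked:
  fixes u :: "real^('t::{finite,linorder} \<times> 'u::finite)" and w :: "real^('t \<times> 'w::finite)"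
    and P :: "('x::finite,'u::finite,'w::finite) lq_system" and x0 :: "real^'x"
  defines "x \<equiv> stacked_state P x0 u w"
  shows "cost_J P x0 u w =
    x \<bullet> (Qbar P *v x) + 2 * (qbar P \<bullet> x) + u \<bullet> (Rbar P *v u) + 2 * (rbar P \<bullet> u)"
proof -
  let ?x = "trajectory P x0 (block u) (block w)"
  have "(\<Sum>k=1..CARD('t). ?x k \<bullet> (cost_Q P k *v ?x k) + 2 * (cost_q P k \<bullet> ?x k)) =
     (\<Sum>k<CARD('t). ?x (Suc k) \<bullet> (cost_Q P (Suc k) *v ?x (Suc k)) +
        2 * (cost_q P (Suc k) \<bullet> ?x (Suc k)))"
    by (rule sum.reindex_bij_witness[of _ Suc "\<lambda>k. k - 1"]) auto
  then show ?thesis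
    unfolding cost_J_def Let_def x_def
    by (simp add: inner_stacked sum.distrib sum_distrib_left block_blkdiag block_stacked
        Qbar_def Rbar_def qbar_def rbar_def stacked_state_def del: trajectory.simps)
qed

lemma cost_J_compact:
  fixes u :: "real^('t::{finite,linorder} \<times> 'u::finite)" and w :: "real^('t \<times> 'w::finite)"
    and P :: "('x::finite,'u::finite,'w::finite) lq_system" and x0 :: "real^'x"
  assumes "\<And>k. k \<in> {1..CARD('t)} \<Longrightarrow> transpose (cost_Q P k) = cost_Q P k"
  shows "cost_J P x0 u w =
    w \<bullet> (bigC P *v w) + 2 * ((vec_c P x0 + transpose (bigD P) *v u) \<bullet> w)
    + u \<bullet> (bigB P *v u) + 2 * (vec_b P x0 \<bullet> u)
    + 2 * (vec_a TYPE('t) P \<bullet> x0) + x0 \<bullet> (bigA TYPE('t) P *v x0)"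
proof -
  let ?Q = "Qbar P :: real^('t \<times> 'x)^('t \<times> 'x)"
  let ?a = "scrA P *v x0 :: real^('t \<times> 'x)"
  let ?b = "scrB P *v u :: real^('t \<times> 'x)"
  let ?c = "scrC P *v w :: real^('t \<times> 'x)"
  have Q: "transpose ?Q = ?Q"
    unfolding Qbar_def using assms by (intro transpose_blkdiag) auto
  have sym: "y \<bullet> (?Q *v z) = z \<bullet> (?Q *v y)" for y z
    by (metis Q dot_lmul_matrix inner_commute transpose_matrix_vector)
  have T: "z \<bullet> (y v* M) = (M *v z) \<bullet> y" "(y v* M) \<bullet> z = y \<bullet> (M *v z)"
    for M :: "real^'m::finite^'k::finite" and y z
    by (metis dot_lmul_matrix inner_commute)+
  have comm: "(?Q *v y) \<bullet> z = z \<bullet> (?Q *v y)" for y z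
    by (rule inner_commute)
  have TD: "transpose (bigD P :: real^('t \<times> 'w)^('t \<times> 'u)) = transpose (scrC P) ** ?Q ** scrB P"
    by (simp add: bigD_def matrix_transpose_mul Q matrix_mul_assoc)
  note mv = matrix_vector_mul_assoc[symmetric]
  have "w \<bullet> (bigC P *v w) = ?c \<bullet> (?Q *v ?c)"
    by (simp add: bigC_def mv T)
  moreover have "(vec_c P x0 + transpose (bigD P) *v u) \<bullet> w =
      qbar P \<bullet> ?c + ?a \<bullet> (?Q *v ?c) + ?b \<bullet> (?Q *v ?c)"
    unfolding TD by (simp add: vec_c_def mv T inner_add_left comm sym[of ?c])
  moreover have "u \<bullet> (bigB P *v u) = ?b \<bullet> (?Q *v ?b) + u \<bullet> (Rbar P *v u)"
    by (simp add: bigB_def mv T matrix_vector_mult_add_rdistrib inner_add_right)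
  moreover have "vec_b P x0 \<bullet> u = rbar P \<bullet> u + qbar P \<bullet> ?b + ?a \<bullet> (?Q *v ?b)"
    by (simp add: vec_b_def mv T inner_add_left comm sym[of ?b])
  moreover have "vec_a TYPE('t) P \<bullet> x0 = qbar P \<bullet> ?a" "x0 \<bullet> (bigA TYPE('t) P *v x0) = ?a \<bullet> (?Q *v ?a)"
    by (simp_all add: vec_a_def bigA_def mv T)
  moreover have "cost_J P x0 u w =
      (?a + ?b + ?c) \<bullet> (?Q *v ?a + ?Q *v ?b + ?Q *v ?c) + 2 * (qbar P \<bullet> (?a + ?b + ?c))
      + u \<bullet> (Rbar P *v u) + 2 * (rbar P \<bullet> u)"
    by (simp only: cost_J_stacked stacked_state_linear matrix_vector_right_distrib)
  ultimately show ?thesis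
    using sym[of ?b ?a] sym[of ?c ?a] sym[of ?c ?b]
    by (simp only: inner_add_left inner_add_right distrib_left)
qed


section \<open>The min-max problem and its conic reformulation\<close>

text \<open>
  The supremum below is a maximum, by \<open>worst_case_attained\<close>.  Optimal values are infima in
  the extended reals, so that the value of an infeasible problem is \<open>\<infinity>\<close>.
\<close>

definition disturbances :: "real \<Rightarrow> (real^'m) set" where
  "disturbances \<gamma> = {w. norm w \<le> \<gamma>}"

definition worst_case :: "('x::finite,'u::finite,'w::finite) lq_system \<Rightarrow> real^'x \<Rightarrow> real \<Rightarrow>
    real^('t::{finite,linorder} \<times> 'u) \<Rightarrow> ereal" where
  "worst_case P x0 \<gamma> u = (SUP w\<in>disturbances \<gamma>. ereal (cost_J P x0 u w))"

definition optimal_value :: "('v \<Rightarrow> ereal) \<Rightarrow> 'v set \<Rightarrow> ereal" where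
  "optimal_value f X = (INF v\<in>X. f v)"

definition cone_Q :: "(real \<times> real \<times> real) set" where
  "cone_Q = {(x, y, z). norm (2 * x, y - z) \<le> y + z}"

definition diag :: "real^'m \<Rightarrow> real^'m^'m" where
  "diag d = (\<chi> i j. if i = j then d $ i else 0)"

definition diagonalizes :: "('x::finite,'u::finite,'w::finite) lq_system \<Rightarrow> real^('t::{finite,linorder} \<times> 'w)^('t \<times> 'w) \<Rightarrow>
    real^('t \<times> 'w) \<Rightarrow> real^('t \<times> 'w) \<Rightarrow> bool" where
  "diagonalizes P S \<sigma> \<tau> \<longleftrightarrow> invertible S \<and>
     transpose S ** S = diag \<sigma> \<and> transpose S ** bigC P ** S = diag \<tau>"

definition R_feasible :: "('x::finite,'u::finite,'w::finite) lq_system \<Rightarrow> real^'x \<Rightarrow>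
    (real^('t::{finite,linorder} \<times> 'u)) set \<Rightarrow> real^('t \<times> 'w)^('t \<times> 'w) \<Rightarrow>
    real^('t \<times> 'w) \<Rightarrow> real^('t \<times> 'w) \<Rightarrow>
    ((real^('t \<times> 'u)) \<times> real \<times> (real^('t \<times> 'w))) set" where
  "R_feasible P x0 U S \<sigma> \<tau> = {(u, l, t). u \<in> U \<and> 0 \<le> l \<and>
     (\<forall>i. ((transpose S *v (vec_c P x0 + transpose (bigD P) *v u)) $ i,
           t $ i, l * \<sigma> $ i - \<tau> $ i) \<in> cone_Q)}"

definition R_objective :: "('x::finite,'u::finite,'w::finite) lq_system \<Rightarrow> real^'x \<Rightarrow> real \<Rightarrow>
    (real^('t::{finite,linorder} \<times> 'u)) \<times> real \<times> (real^('t \<times> 'w)) \<Rightarrow> real" where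
  "R_objective P x0 \<gamma> = (\<lambda>(u, l, t).
     u \<bullet> (bigB P *v u) + 2 * (vec_b P x0 \<bullet> u) + 1 \<bullet> t + \<gamma>\<^sup>2 * l)"

lemma worst_case_attained:
  fixes u :: "real^('t::{finite,linorder} \<times> 'u::finite)"
    and P :: "('x::finite,'u,'w::finite) lq_system"
  assumes "0 \<le> \<gamma>" and "\<And>k. k \<in> {1..CARD('t)} \<Longrightarrow> transpose (cost_Q P k) = cost_Q P k"
  shows "\<exists>w\<in>disturbances \<gamma>. worst_case P x0 \<gamma> u = ereal (cost_J P x0 u w) \<and>
           (\<forall>w'\<in>disturbances \<gamma>. cost_J P x0 u w' \<le> cost_J P x0 u w)"
proof -
  have D: "disturbances \<gamma> = cball (0 :: real^('t \<times> 'w)) \<gamma>"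
    by (auto simp: disturbances_def)
  have J: "cost_J P x0 u = (\<lambda>w. w \<bullet> (bigC P *v w) + 2 * ((vec_c P x0 + transpose (bigD P) *v u) \<bullet> w)
      + u \<bullet> (bigB P *v u) + 2 * (vec_b P x0 \<bullet> u)
      + 2 * (vec_a TYPE('t) P \<bullet> x0) + x0 \<bullet> (bigA TYPE('t) P *v x0))"
    by (rule ext, rule cost_J_compact, rule assms(2))
  have "continuous_on (disturbances \<gamma>) (cost_J P x0 u)"
    unfolding J by (intro continuous_intros matrix_vector_mult_linear_continuous_on)
  moreover have "compact (disturbances \<gamma> :: (real^('t \<times> 'w)) set)" "disturbances \<gamma> \<noteq> ({} :: (real^('t \<times> 'w)) set)"
    using assms(1) by (auto simp: D)
  ultimately obtain w where w: "w \<in> disturbances \<gamma>"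
      "\<forall>w'\<in>disturbances \<gamma>. cost_J P x0 u w' \<le> cost_J P x0 u w"
    using continuous_attains_sup by metis
  then have "worst_case P x0 \<gamma> u = ereal (cost_J P x0 u w)"
    unfolding worst_case_def by (intro SUP_eqI) auto
  with w show ?thesis by blast
qed


section \<open>Second-order cone programs\<close>

text \<open>
  Numbers of variables and of rows vary inside the statements, so here \<open>\<real>\<^sup>n\<close> consists of the
  functions on \<open>nat\<close> vanishing from \<open>n\<close> on, and of the entries of a matrix or vector only
  those within the stated dimensions count.
\<close>

definition rvecs :: "nat \<Rightarrow> (nat \<Rightarrow> real) set" where
  "rvecs n = {x. \<forall>j\<ge>n. x j = 0}"

definition rdot :: "nat \<Rightarrow> (nat \<Rightarrow> real) \<Rightarrow> (nat \<Rightarrow> real) \<Rightarrow> real" where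
  "rdot n c x = (\<Sum>j<n. c j * x j)"

record soc_constraint =
  cone_rows :: nat
  cone_mat :: "nat \<Rightarrow> nat \<Rightarrow> real"
  cone_off :: "nat \<Rightarrow> real"
  cone_lin :: "nat \<Rightarrow> real"
  cone_const :: real

record soc_system =
  num_vars :: nat
  cones :: "soc_constraint list"
  eq_rows :: nat
  eq_mat :: "nat \<Rightarrow> nat \<Rightarrow> real"
  eq_rhs :: "nat \<Rightarrow> real"

record socp = soc_system +
  objective :: "nat \<Rightarrow> real"

definition soc_satisfied :: "nat \<Rightarrow> soc_constraint \<Rightarrow> (nat \<Rightarrow> real) \<Rightarrow> bool" where
  "soc_satisfied n K x \<longleftrightarrow>
     L2_set (\<lambda>i. rdot n (cone_mat K i) x + cone_off K i) {..<cone_rows K}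
       \<le> rdot n (cone_lin K) x + cone_const K"

definition soc_feasible :: "'z soc_system_scheme \<Rightarrow> (nat \<Rightarrow> real) set" where
  "soc_feasible Z = {x \<in> rvecs (num_vars Z).
     (\<forall>K\<in>set (cones Z). soc_satisfied (num_vars Z) K x) \<and>
     (\<forall>i<eq_rows Z. rdot (num_vars Z) (eq_mat Z i) x = eq_rhs Z i)}"

definition socp_objective :: "socp \<Rightarrow> (nat \<Rightarrow> real) \<Rightarrow> real" where
  "socp_objective Z x = rdot (num_vars Z) (objective Z) x"

definition coord_selection :: "nat \<Rightarrow> ('n \<Rightarrow> nat) \<Rightarrow> bool" where
  "coord_selection n p \<longleftrightarrow> inj p \<and> range p \<subseteq> {..<n}"

definition proj :: "('n \<Rightarrow> nat) \<Rightarrow> (nat \<Rightarrow> real) \<Rightarrow> real^'n" where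
  "proj p x = (\<chi> i. x (p i))"

definition soc_representable :: "(real^'n) set \<Rightarrow> bool" where
  "soc_representable X \<longleftrightarrow>
     (\<exists>(Z::soc_system) p. coord_selection (num_vars Z) p \<and> X = proj p ` soc_feasible Z)"

text \<open>
  Exact reformulation of minimizing \<open>f\<close> over \<open>X\<close> as the second-order cone program \<open>Z\<close>, the
  original variable being part of the variables of \<open>Z\<close>.  Besides equal optimal values and
  corresponding optimal solutions it is required that the cone program describes the
  epigraph of \<open>f\<close> on \<open>X\<close>: mere agreement of the value and of the solutions would, for an
  already solved problem, be achieved by a program listing its solution.
\<close>

definition socp_reformulation ::
    "(real^'n \<Rightarrow> ereal) \<Rightarrow> (real^'n) set \<Rightarrow> socp \<Rightarrow> ('n \<Rightarrow> nat) \<Rightarrow> bool" where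
  "socp_reformulation f X Z p \<longleftrightarrow>
     coord_selection (num_vars Z) p \<and>
     optimal_value f X = optimal_value (\<lambda>x. ereal (socp_objective Z x)) (soc_feasible Z) \<and>
     (\<forall>v. is_arg_min f (\<lambda>v. v \<in> X) v \<longleftrightarrow>
        (\<exists>x. proj p x = v \<and> is_arg_min (socp_objective Z) (\<lambda>x. x \<in> soc_feasible Z) x)) \<and>
     (\<forall>v (s::real). v \<in> X \<and> f v \<le> ereal s \<longleftrightarrow>
        (\<exists>x\<in>soc_feasible Z. proj p x = v \<and> socp_objective Z x \<le> s))"

end

theory Submission
  imports Defs
begin

text \<open>
  For fixed \<open>u\<close> the inner problem maximizes a convex quadratic function of \<open>w\<close> over a ball.  Such
  a trust-region problem has no duality gap although it is not concave: a maximizer over the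
  sphere has a multiplier \<open>l\<close> that makes \<open>l I - bigC P\<close> positive semidefinite
  (\<open>sphere_maximizer_multiplier\<close>).  In the coordinates \<open>w = S y\<close> that diagonalize both the norm and
  \<open>bigC P\<close> the Lagrangian is a sum of functions of one variable,
  \<open>2 d y - (l \<sigma> - \<tau>) y\<^sup>2\<close>, and \<open>t\<close> bounds such a function exactly if \<open>(d, t, l \<sigma> - \<tau>)\<close> lies in the
  cone.  Hence the inner maximum is the minimum of \<open>1 \<bullet> t + \<gamma>\<^sup>2 l\<close> over the cone constraints, and the
  minimum is attained (\<open>ball_quadratic_weak_duality\<close>, \<open>ball_quadratic_strong_duality\<close>).

  Attainment turns the minimization over \<open>u\<close>, \<open>l\<close> and \<open>t\<close> into a lift of the min-max problem: each
  feasible point of (R) overestimates the worst case, and over each \<open>u\<close> some feasible point is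
  exact.  This alone gives equal values, corresponding minimizers and equal epigraphs
  (\<open>lifted_minimization\<close>).  The matrix \<open>S\<close> exists by the spectral theorem
  (\<open>symmetric_matrix_orthogonally_diagonalizable\<close>), with \<open>\<sigma> = 1\<close>.

  For the cone program, the epigraph of the objective of (R) is conic because \<open>bigB P\<close> is positive
  semidefinite, so that its quadratic form is a sum of squares; appending these constraints to those
  that represent \<open>U\<close> gives the program, again as a lift (\<open>socp_reformulation_of_epigraph\<close>).
\<close>

section \<open>Diagonalizing symmetric matrices\<close>

lemma quadratic_nonpos_at_0:
  fixes c a b :: real
  assumes "\<And>s. s > 0 \<Longrightarrow> c + s * a + s\<^sup>2 * b \<le> 0"
  shows "c \<le> 0"
proof (rule tendsto_upperbound)
  show "((\<lambda>s. c + s * a + s\<^sup>2 * b) \<longlongrightarrow> c) (at_right 0)"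
    by (auto intro!: tendsto_eq_intros)
  show "\<forall>\<^sub>F s in at_right 0. c + s * a + s\<^sup>2 * b \<le> 0"
    using assms by (auto simp: eventually_at_right_less eventually_at_filter)
qed simp

text \<open>
  The first-order condition without derivatives: comparing an extremal point with points at
  parameter \<open>s\<close> along a curve gives such an inequality, in which the linear term can be dominated
  by the quadratic one for small \<open>s\<close> of both signs only if it vanishes.
\<close>

lemma first_order_zero:
  fixes a b :: real
  assumes "\<And>s. s \<noteq> 0 \<Longrightarrow> s * a \<le> s\<^sup>2 * b"
  shows "a = 0"
proof -
  have "a \<le> 0"
  proof (rule quadratic_nonpos_at_0[of _ "-b" 0])
    fix s :: real assume "s > 0"
    then show "a + s * - b + s\<^sup>2 * 0 \<le> 0"
      using assms[of s] by (simp add: power2_eq_square)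
  qed
  moreover have "- a \<le> 0"
  proof (rule quadratic_nonpos_at_0[of _ "-b" 0])
    fix s :: real assume "s > 0"
    then have "s * (- a - s * b) \<le> 0"
      using assms[of "-s"] by (simp add: power2_eq_square algebra_simps)
    with \<open>s > 0\<close> show "- a + s * - b + s\<^sup>2 * 0 \<le> 0"
      by (simp add: mult_le_0_iff)
  qed
  ultimately show ?thesis by simp
qed

lemma symmetric_inner:
  fixes M :: "real^'n^'n"
  assumes "transpose M = M"
  shows "(M *v x) \<bullet> y = x \<bullet> (M *v y)"
  by (metis assms dot_lmul_matrix transpose_matrix_vector)

lemma transpose_inner:
  fixes M :: "real^'n^'m"
  shows "(transpose M *v x) \<bullet> y = x \<bullet> (M *v y)"
  by (simp add: dot_lmul_matrix)

text \<open>
  The eigenvector is a maximizer of the Rayleigh quotient over the unit sphere of \<open>V\<close>: moving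
  from it along its residual, which lies in \<open>V\<close> by invariance, must not increase the quotient.
\<close>

lemma symmetric_eigenvector_in_subspace:
  fixes M :: "real^'n^'n"
  assumes sym: "transpose M = M" and V: "subspace V" and inv: "\<And>x. x \<in> V \<Longrightarrow> M *v x \<in> V"
    and ne: "v \<in> V" "v \<noteq> 0"
  obtains x c where "x \<in> V" "norm x = 1" "M *v x = c *\<^sub>R x"
proof -
  let ?K = "sphere 0 1 \<inter> V"
  have "compact ?K"
    by (simp add: V closed_subspace compact_Int_closed)
  moreover have "?K \<noteq> {}"
  proof -
    have "(1 / norm v) *\<^sub>R v \<in> ?K"
      using ne V by (simp add: subspace_scale)
    then show ?thesis by blast
  qed
  moreover have "continuous_on ?K (\<lambda>x. x \<bullet> (M *v x))"
    by (intro continuous_intros matrix_vector_mult_linear_continuous_on)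
  ultimately obtain x where "x \<in> ?K" "\<forall>y\<in>?K. y \<bullet> (M *v y) \<le> x \<bullet> (M *v x)"
    using continuous_attains_sup[of ?K "\<lambda>x. x \<bullet> (M *v x)"] by blast
  then have x: "x \<in> V" "norm x = 1"
    and max: "\<And>y. y \<in> V \<Longrightarrow> norm y = 1 \<Longrightarrow> y \<bullet> (M *v y) \<le> x \<bullet> (M *v x)"
    by auto
  define c where "c = x \<bullet> (M *v x)"
  have le: "z \<bullet> (M *v z) \<le> c * (z \<bullet> z)" if "z \<in> V" for z
  proof (cases "z = 0")
    case False
    have "(1 / norm z) *\<^sub>R z \<bullet> (M *v ((1 / norm z) *\<^sub>R z)) \<le> c"
      unfolding c_def using False that V by (intro max) (auto simp: subspace_scale)
    then show ?thesis
      using False by (simp add: matrix_vector_mult_scaleR divide_simps power2_eq_square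
          flip: power2_norm_eq_inner)
  qed simp
  define r where "r = M *v x - c *\<^sub>R x"
  have xx: "x \<bullet> x = 1"
    using x by (simp flip: power2_norm_eq_inner)
  have rV: "r \<in> V"
    using x V inv by (simp add: r_def subspace_diff subspace_scale)
  have "s * (2 * (r \<bullet> r)) \<le> s\<^sup>2 * (c * (r \<bullet> r) - r \<bullet> (M *v r))" for s
  proof -
    have "(x + s *\<^sub>R r) \<bullet> (M *v (x + s *\<^sub>R r)) \<le> c * ((x + s *\<^sub>R r) \<bullet> (x + s *\<^sub>R r))"
      using x rV V by (intro le) (simp add: subspace_add subspace_scale)
    moreover have "x \<bullet> (M *v r) = r \<bullet> (M *v x)"
      using symmetric_inner[OF sym, of r x] by (simp add: symmetric_inner[OF sym] inner_commute)
    moreover have "r \<bullet> (M *v x) = r \<bullet> r + c * (x \<bullet> r)"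
      by (simp add: r_def inner_diff_right inner_diff_left inner_commute algebra_simps)
    ultimately show ?thesis
      by (simp add: matrix_vector_right_distrib matrix_vector_mult_scaleR inner_add_left
          inner_add_right xx c_def[symmetric] inner_commute[of r x] power2_eq_square algebra_simps)
  qed
  then have "2 * (r \<bullet> r) = 0"
    by (rule first_order_zero)
  then have "r = 0" by simp
  then show ?thesis
    using that[of x c] x by (simp add: r_def)
qed

text \<open>
  The columns of \<open>S\<close> form an orthonormal set of eigenvectors of maximal cardinality.  Were it
  smaller than the dimension, its orthogonal complement would be a nonzero invariant subspace and
  contain a further eigenvector.
\<close>

theorem symmetric_matrix_orthogonally_diagonalizable:
  fixes M :: "real^'n^'n"
  assumes sym: "transpose M = M"
  obtains S \<tau> where "orthogonal_matrix S" "transpose S ** M ** S = diag \<tau>"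
proof -
  define good :: "(real^'n) set \<Rightarrow> bool" where
    "good E \<longleftrightarrow> pairwise orthogonal E \<and> (\<forall>x\<in>E. norm x = 1 \<and> (\<exists>c. M *v x = c *\<^sub>R x))" for E
  have indep: "independent E" if "good E" for E
    using that by (intro pairwise_orthogonal_independent) (auto simp: good_def)
  have bound: "finite E \<and> card E \<le> CARD('n)" if "good E" for E
    using independent_bound[OF indep[OF that]] by simp
  have "good {}" by (simp add: good_def)
  then obtain E where E: "good E" and maxE: "\<And>E'. good E' \<Longrightarrow> card E' \<le> card E"
    using ex_has_greatest_nat[of good "{}" card "CARD('n) + 1"] bound by (metis le_imp_less_Suc Suc_eq_plus1)
  have finE: "finite E" using bound E by blast
  let ?V = "{y. \<forall>x\<in>E. orthogonal x y}"
  have "card E = CARD('n)"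
  proof (rule ccontr)
    assume "card E \<noteq> CARD('n)"
    then have "dim E < DIM(real^'n)"
      using bound[OF E] indep[OF E] by (simp add: dim_eq_card_independent)
    then obtain v where v: "v \<noteq> 0" "\<And>y. y \<in> span E \<Longrightarrow> orthogonal v y"
      using orthogonal_to_subspace_exists by metis
    have inv: "M *v y \<in> ?V" if "y \<in> ?V" for y
    proof -
      have "x \<bullet> (M *v y) = 0" if "x \<in> E" for x
      proof -
        obtain c where "M *v x = c *\<^sub>R x" using E \<open>x \<in> E\<close> by (auto simp: good_def)
        then show ?thesis
          using \<open>y \<in> ?V\<close> \<open>x \<in> E\<close> symmetric_inner[OF sym, of x y] by (simp add: orthogonal_def)
      qed
      then show ?thesis by (simp add: orthogonal_def)
    qed
    obtain x c where x: "x \<in> ?V" "norm x = 1" "M *v x = c *\<^sub>R x"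
      using symmetric_eigenvector_in_subspace[OF sym subspace_orthogonal_to_vectors inv, of v] v
      by (auto simp: orthogonal_commute span_base)
    have "x \<notin> E"
      using x by (auto simp: orthogonal_def)
    moreover have "good (insert x E)"
      using x E by (auto simp: good_def pairwise_insert orthogonal_commute)
    ultimately show False
      using maxE[of "insert x E"] finE by simp
  qed
  then obtain e :: "'n \<Rightarrow> real^'n" where e: "bij_betw e UNIV E"
    using finE finite_same_card_bij[of "UNIV :: 'n set" E] by auto
  define S :: "real^'n^'n" where "S = (\<chi> i j. e j $ i)"
  have col: "column j S = e j" for j
    by (simp add: S_def column_def vec_eq_iff)
  have eE: "e j \<in> E" for j
    using e by (auto simp: bij_betw_def)
  have ee: "e i \<bullet> e j = (if i = j then 1 else 0)" for i j
  proof (cases "i = j")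
    case True
    then show ?thesis
      using E eE[of j] by (simp add: good_def norm_eq_1)
  next
    case False
    then have "e i \<noteq> e j"
      using e by (auto simp: bij_betw_def inj_eq)
    then show ?thesis
      using False E eE[of i] eE[of j] by (auto simp: good_def pairwise_def orthogonal_def)
  qed
  have eig: "\<forall>j. \<exists>c. M *v e j = c *\<^sub>R e j"
    using E eE by (auto simp: good_def)
  obtain \<mu> where \<mu>: "\<And>j. M *v e j = \<mu> j *\<^sub>R e j"
    using choice[OF eig] by blast
  have "orthogonal_matrix S"
    by (simp add: orthogonal_matrix_orthonormal_columns col orthogonal_def norm_eq_1 ee)
  moreover have "transpose S ** M ** S = diag (\<chi> j. \<mu> j)"
  proof -
    have "(transpose S ** M ** S) $ i $ j = e i \<bullet> (M *v e j)" for i j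
    proof -
      have "(transpose S ** M ** S) $ i $ j = row i (transpose S) \<bullet> column j (M ** S)"
        by (simp only: matrix_mul_assoc[symmetric] matrix_mult_dot vec_lambda_beta)
          (simp add: matrix_matrix_mult_def inner_vec_def row_def column_def)
      also have "column j (M ** S) = M *v column j S"
        by (simp add: vec_eq_iff column_def matrix_matrix_mult_def matrix_vector_mult_def)
      finally show ?thesis by (simp add: row_transpose col)
    qed
    then show ?thesis
      by (auto simp: vec_eq_iff diag_def \<mu> ee)
  qed
  ultimately show thesis by (rule that)
qed

lemma diag_mult_vec: "diag d *v y = (\<chi> i. d $ i * y $ i)"
  by (simp add: diag_def matrix_vector_mult_def vec_eq_iff if_distrib[of "\<lambda>x. x * _"] cong: if_cong)

lemma inner_congruence_diag:
  fixes S M :: "real^'n^'n"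
  assumes "transpose S ** M ** S = diag d"
  shows "(S *v y) \<bullet> (M *v (S *v y)) = (\<Sum>i\<in>UNIV. d $ i * (y $ i)\<^sup>2)"
proof -
  have "(S *v y) \<bullet> (M *v (S *v y)) = y \<bullet> ((transpose S ** M ** S) *v y)"
    by (metis matrix_vector_mul_assoc transpose_inner inner_commute)
  then show ?thesis
    unfolding assms by (simp add: diag_mult_vec inner_vec_def power2_eq_square mult_ac)
qed

lemma inner_congruence_diag_axis:
  fixes S M :: "real^'n^'n"
  assumes "transpose S ** M ** S = diag d"
  shows "(S *v axis i 1) \<bullet> (M *v (S *v axis i 1)) = d $ i"
  unfolding inner_congruence_diag[OF assms]
  by (simp add: axis_def if_distrib[of "\<lambda>x. x\<^sup>2"] if_distrib[of "\<lambda>x. _ * x"] cong: if_cong)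

text \<open>
  \<open>T\<close> is a square root of \<open>M\<close> up to an orthogonal factor.  Quadratic costs enter a second-order
  cone constraint only in this form.
\<close>

lemma sym_pos_semidef_sum_squares:
  fixes M :: "real^'n^'n"
  assumes "sym_pos_semidef M"
  obtains T :: "real^'n^'n" where "\<And>u. u \<bullet> (M *v u) = (\<Sum>i\<in>UNIV. ((T *v u) $ i)\<^sup>2)"
proof -
  obtain S \<beta> where S: "orthogonal_matrix S" and \<beta>: "transpose S ** M ** S = diag \<beta>"
    using symmetric_matrix_orthogonally_diagonalizable assms unfolding sym_pos_semidef_def by metis
  have pos: "\<beta> $ i \<ge> 0" for i
    using inner_congruence_diag_axis[OF \<beta>, of i] assms
    by (metis sym_pos_semidef_def)
  define T where "T = diag (\<chi> i. sqrt (\<beta> $ i)) ** transpose S"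
  have "u \<bullet> (M *v u) = (\<Sum>i\<in>UNIV. ((T *v u) $ i)\<^sup>2)" for u
  proof -
    have u: "S *v (transpose S *v u) = u"
      using S by (simp only: matrix_vector_mul_assoc orthogonal_matrix_def matrix_vector_mul_lid)
    have "T *v u = diag (\<chi> i. sqrt (\<beta> $ i)) *v (transpose S *v u)"
      by (simp only: T_def matrix_vector_mul_assoc)
    then have "((T *v u) $ i)\<^sup>2 = \<beta> $ i * ((transpose S *v u) $ i)\<^sup>2" for i
      using pos[of i] by (simp only: diag_mult_vec vec_lambda_beta power_mult_distrib real_sqrt_pow2)
    then show ?thesis
      using inner_congruence_diag[OF \<beta>, of "transpose S *v u"] by (simp only: u)
  qed
  then show thesis by (rule that)
qed

section \<open>Maximizing a convex quadratic over a ball\<close>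

text \<open>
  Optimality conditions of the trust-region problem, with the global condition that \<open>l I - C\<close> is
  positive semidefinite instead of the merely local one.  A maximizer \<open>w\<close> over the sphere is
  compared with its reflections in the hyperplanes orthogonal to arbitrary \<open>z\<close>; these comparisons
  are exact quadratic inequalities, so they give the multiplier and the semidefiniteness at once.
  Maximizing over the sphere instead of the ball makes complementary slackness automatic; that the
  maximum over the ball is no larger follows from weak duality below.
\<close>

lemma sphere_maximizer_multiplier:
  fixes C :: "real^'n^'n" and g :: "real^'n"
  assumes C: "sym_pos_semidef C" and "\<gamma> > 0"
  obtains w l where "norm w = \<gamma>" "l \<ge> 0" "C *v w + g = l *\<^sub>R w"
    "\<And>z. z \<bullet> (C *v z) \<le> l * (z \<bullet> z)"
proof -
  have sym: "transpose C = C" and psd: "\<And>x. 0 \<le> x \<bullet> (C *v x)"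
    using C by (auto simp: sym_pos_semidef_def)
  define q where "q = (\<lambda>w. w \<bullet> (C *v w) + 2 * (g \<bullet> w))"
  have "continuous_on (sphere 0 \<gamma>) q"
    unfolding q_def by (intro continuous_intros matrix_vector_mult_linear_continuous_on)
  moreover have "sphere (0::real^'n) \<gamma> \<noteq> {}"
    using \<open>\<gamma> > 0\<close> by simp
  ultimately obtain w where "w \<in> sphere 0 \<gamma>" "\<forall>v\<in>sphere 0 \<gamma>. q v \<le> q w"
    using continuous_attains_sup[OF compact_sphere, of 0 \<gamma> q] by blast
  then have w: "norm w = \<gamma>" and max: "\<And>v. norm v = \<gamma> \<Longrightarrow> q v \<le> q w"
    by auto
  have ww: "w \<bullet> w = \<gamma>\<^sup>2"
    using w by (simp flip: power2_norm_eq_inner)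
  have swap: "y \<bullet> (C *v x) = x \<bullet> (C *v y)" for x y
    by (metis symmetric_inner[OF sym] inner_commute)
  define h where "h = C *v w + g"
  have reflect: "(z \<bullet> w)\<^sup>2 * (z \<bullet> (C *v z)) \<le> (z \<bullet> w) * (z \<bullet> h) * (z \<bullet> z)" for z
  proof (cases "z = 0")
    case False
    \<comment> \<open>the point \<open>w - s z\<close> is the reflection of \<open>w\<close> in the hyperplane orthogonal to \<open>z\<close>\<close>
    define s where "s = 2 * (z \<bullet> w) / (z \<bullet> z)"
    have zz: "z \<bullet> z > 0" using False by simp
    have sz: "s * (z \<bullet> z) = 2 * (z \<bullet> w)" using zz by (simp add: s_def)
    let ?v = "w - s *\<^sub>R z"
    have "?v \<bullet> ?v = w \<bullet> w - s * (2 * (z \<bullet> w) - s * (z \<bullet> z))"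
      by (simp add: inner_diff_left inner_diff_right inner_commute[of w z] algebra_simps)
    then have "norm ?v = \<gamma>"
      using w by (simp add: sz norm_eq_sqrt_inner)
    from max[OF this] have "s * (s * (z \<bullet> (C *v z))) \<le> s * (2 * (z \<bullet> h))"
      by (simp add: q_def h_def matrix_vector_mult_diff_distrib matrix_vector_mult_scaleR
          inner_diff_left inner_diff_right inner_add_right swap[of w z] inner_commute[of g]
          algebra_simps)
    then have "(z \<bullet> z)\<^sup>2 * (s * (s * (z \<bullet> (C *v z)))) \<le> (z \<bullet> z)\<^sup>2 * (s * (2 * (z \<bullet> h)))"
      by (rule mult_left_mono) simp
    then have "(s * (z \<bullet> z))\<^sup>2 * (z \<bullet> (C *v z)) \<le> (s * (z \<bullet> z)) * (2 * (z \<bullet> h)) * (z \<bullet> z)"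
      by (simp add: power2_eq_square mult_ac)
    then show ?thesis
      unfolding sz by (simp add: power2_eq_square mult_ac)
  qed simp
  define l where "l = (w \<bullet> h) / \<gamma>\<^sup>2"
  have wh: "w \<bullet> h = l * \<gamma>\<^sup>2"
    using \<open>\<gamma> > 0\<close> by (simp add: l_def)
  \<comment> \<open>the tangential part of half the gradient; it vanishes by the reflections for \<open>z\<close> close to \<open>p\<close>\<close>
  define p where "p = h - l *\<^sub>R w"
  have pw: "p \<bullet> w = 0"
    by (simp add: p_def inner_diff_left ww wh inner_commute[of h])
  have ph: "p \<bullet> h = p \<bullet> p"
    using pw by (simp add: p_def inner_diff_left inner_diff_right inner_commute algebra_simps)
  have "s * - (p \<bullet> p) \<le> s\<^sup>2 * (l * \<gamma>\<^sup>2)" if "s \<noteq> 0" for s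
  proof -
    let ?z = "p + s *\<^sub>R w"
    have zw: "?z \<bullet> w = s * \<gamma>\<^sup>2" and zh: "?z \<bullet> h = p \<bullet> p + s * (l * \<gamma>\<^sup>2)"
      by (simp_all add: inner_add_left pw ww ph wh)
    have "0 \<le> (?z \<bullet> w)\<^sup>2 * (?z \<bullet> (C *v ?z))"
      using psd by simp
    also note reflect[of ?z]
    finally have "0 \<le> \<gamma>\<^sup>2 * (s * (p \<bullet> p + s * (l * \<gamma>\<^sup>2)) * (?z \<bullet> ?z))"
      unfolding zw zh by (simp add: mult_ac)
    moreover have "?z \<bullet> ?z > 0"
      using zw that \<open>\<gamma> > 0\<close> by (metis inner_gt_zero_iff inner_zero_left mult_eq_0_iff less_irrefl power_not_zero)
    ultimately have "0 \<le> s * (p \<bullet> p + s * (l * \<gamma>\<^sup>2))"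
      using \<open>\<gamma> > 0\<close> by (simp add: zero_le_mult_iff)
    then show ?thesis by (simp add: power2_eq_square algebra_simps)
  qed
  then have "- (p \<bullet> p) = 0"
    by (rule first_order_zero)
  then have h: "h = l *\<^sub>R w"
    by (simp add: p_def)
  have le': "z \<bullet> (C *v z) \<le> l * (z \<bullet> z)" if "z \<bullet> w \<noteq> 0" for z
  proof -
    have "(z \<bullet> w)\<^sup>2 * (z \<bullet> (C *v z)) \<le> (z \<bullet> w)\<^sup>2 * (l * (z \<bullet> z))"
      using reflect[of z] by (simp add: h power2_eq_square mult_ac)
    then show ?thesis
      using that by simp
  qed
  \<comment> \<open>reflection says nothing about \<open>z\<close> tangent to the sphere, so tilt \<open>z\<close> towards \<open>w\<close> and pass to the limit\<close>
  have le: "z \<bullet> (C *v z) \<le> l * (z \<bullet> z)" for z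
  proof (cases "z \<bullet> w = 0")
    case True
    have "z \<bullet> (C *v z) - l * (z \<bullet> z) \<le> 0"
    proof (rule quadratic_nonpos_at_0)
      fix s :: real assume "s > 0"
      then have "(z + s *\<^sub>R w) \<bullet> w \<noteq> 0"
        using True \<open>\<gamma> > 0\<close> by (simp add: inner_add_left ww)
      from le'[OF this]
      show "z \<bullet> (C *v z) - l * (z \<bullet> z) + s * (2 * (z \<bullet> (C *v w)))
          + s\<^sup>2 * (w \<bullet> (C *v w) - l * (w \<bullet> w)) \<le> 0"
        using True by (simp add: matrix_vector_right_distrib matrix_vector_mult_scaleR inner_add_left
            inner_add_right inner_commute[of w z] swap[of w z] power2_eq_square algebra_simps)
    qed
    then show ?thesis by simp
  qed (rule le')
  have "0 \<le> w \<bullet> (C *v w)" by (rule psd)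
  also have "\<dots> \<le> l * \<gamma>\<^sup>2" using le[of w] by (simp add: ww)
  finally have "l \<ge> 0"
    using \<open>\<gamma> > 0\<close> by (simp add: zero_le_mult_iff)
  with w h le show thesis
    by (intro that[of w l]) (auto simp: h_def)
qed

lemma cone_Q_iff: "(x, y, z) \<in> cone_Q \<longleftrightarrow> 0 \<le> y \<and> 0 \<le> z \<and> x\<^sup>2 \<le> y * z"
proof -
  have "norm (2 * x, y - z) \<le> y + z \<longleftrightarrow> 0 \<le> y + z \<and> (2 * x)\<^sup>2 + (y - z)\<^sup>2 \<le> (y + z)\<^sup>2"
    by (auto simp: norm_Pair intro: real_le_lsqrt dest: sqrt_le_D order_trans[OF real_sqrt_ge_zero, rotated])
  also have "(2 * x)\<^sup>2 + (y - z)\<^sup>2 \<le> (y + z)\<^sup>2 \<longleftrightarrow> x\<^sup>2 \<le> y * z"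
    by (simp add: power2_eq_square algebra_simps)
  also have "0 \<le> y + z \<and> x\<^sup>2 \<le> y * z \<longleftrightarrow> 0 \<le> y \<and> 0 \<le> z \<and> x\<^sup>2 \<le> y * z"
  proof -
    have "0 \<le> y * z" if "x\<^sup>2 \<le> y * z" using that zero_le_power2[of x] by linarith
    then show ?thesis by (auto simp: zero_le_mult_iff)
  qed
  finally show ?thesis by (simp add: cone_Q_def)
qed

text \<open>
  By the arithmetic-geometric mean inequality, since \<open>x\<^sup>2 \<le> t z\<close>.
\<close>

lemma cone_Q_tangent:
  assumes "(x, t, z) \<in> cone_Q"
  shows "2 * (x * y) \<le> t + z * y\<^sup>2"
proof (cases "z = 0")
  case True
  then show ?thesis using assms by (simp add: cone_Q_iff)
next
  case False
  then have z: "z > 0" "0 \<le> t * z - x\<^sup>2" using assms by (auto simp: cone_Q_iff)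
  have "z * (t + z * y\<^sup>2 - 2 * (x * y)) = (t * z - x\<^sup>2) + (x - z * y)\<^sup>2"
    by (simp add: power2_eq_square algebra_simps)
  also have "\<dots> \<ge> 0" using z by simp
  finally show ?thesis using z by (simp add: zero_le_mult_iff)
qed

lemma invertible_mult_vec_surj:
  fixes S :: "real^'n^'n"
  assumes "invertible S"
  obtains y where "w = S *v y"
  by (metis assms matrix_vector_mul_assoc matrix_vector_mul_lid invertible_def)

text \<open>
  In the coordinates \<open>w = S y\<close> the Lagrangian of the ball constraint separates, and each cone
  constraint bounds one coordinate of it by \<open>t $ i\<close>.
\<close>

lemma ball_quadratic_weak_duality:
  fixes C S :: "real^'n^'n"
  assumes S: "invertible S" and \<sigma>: "transpose S ** S = diag \<sigma>" and \<tau>: "transpose S ** C ** S = diag \<tau>"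
    and "0 \<le> l" and cone: "\<And>i. ((transpose S *v g) $ i, t $ i, l * \<sigma> $ i - \<tau> $ i) \<in> cone_Q"
    and w: "norm w \<le> \<gamma>"
  shows "w \<bullet> (C *v w) + 2 * (g \<bullet> w) \<le> 1 \<bullet> t + \<gamma>\<^sup>2 * l"
proof -
  obtain y where y: "w = S *v y" using invertible_mult_vec_surj[OF S] .
  have ww: "w \<bullet> w = (\<Sum>i\<in>UNIV. \<sigma> $ i * (y $ i)\<^sup>2)"
    using inner_congruence_diag[of S "mat 1" \<sigma> y] \<sigma> by (simp add: y)
  have "g \<bullet> w = (transpose S *v g) \<bullet> y"
    by (simp add: y transpose_inner dot_lmul_matrix)
  then have "w \<bullet> (C *v w) + 2 * (g \<bullet> w)
      = (\<Sum>i\<in>UNIV. \<tau> $ i * (y $ i)\<^sup>2 + 2 * ((transpose S *v g) $ i * y $ i))"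
    using inner_congruence_diag[OF \<tau>, of y] by (simp add: y inner_vec_def sum.distrib sum_distrib_left)
  also have "\<dots> \<le> (\<Sum>i\<in>UNIV. t $ i + l * (\<sigma> $ i * (y $ i)\<^sup>2))"
    using cone_Q_tangent[OF cone] by (intro sum_mono) (simp add: algebra_simps)
  also have "\<dots> = 1 \<bullet> t + l * (w \<bullet> w)"
    unfolding ww by (simp add: sum.distrib sum_distrib_left inner_vec_def)
  also have "\<dots> \<le> 1 \<bullet> t + l * \<gamma>\<^sup>2"
    using w \<open>0 \<le> l\<close> by (intro add_left_mono mult_left_mono) (auto simp flip: power2_norm_eq_inner intro: power_mono)
  finally show ?thesis by (simp add: mult_ac)
qed

text \<open>
  With \<open>l\<close> the multiplier of a maximizer \<open>w = S y\<close> over the sphere, the stationarity condition reads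
  \<open>(transpose S *v g) $ i = (l * \<sigma> $ i - \<tau> $ i) * y $ i\<close> in coordinates, so the choice
  \<open>t $ i = (l * \<sigma> $ i - \<tau> $ i) * (y $ i)\<^sup>2\<close> satisfies every cone constraint with equality; it is
  nonnegative because \<open>l I - C\<close> is positive semidefinite.
\<close>

lemma ball_quadratic_strong_duality:
  fixes C S :: "real^'n^'n"
  assumes C: "sym_pos_semidef C" and "\<gamma> > 0"
    and S: "invertible S" and \<sigma>: "transpose S ** S = diag \<sigma>" and \<tau>: "transpose S ** C ** S = diag \<tau>"
  obtains w l t where "norm w = \<gamma>" "0 \<le> l"
    "\<And>i. ((transpose S *v g) $ i, t $ i, l * \<sigma> $ i - \<tau> $ i) \<in> cone_Q"
    "w \<bullet> (C *v w) + 2 * (g \<bullet> w) = 1 \<bullet> t + \<gamma>\<^sup>2 * l"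
proof -
  obtain w l where w: "norm w = \<gamma>" and "l \<ge> 0" and h: "C *v w + g = l *\<^sub>R w"
    and le: "\<And>z. z \<bullet> (C *v z) \<le> l * (z \<bullet> z)"
    using sphere_maximizer_multiplier[OF C \<open>\<gamma> > 0\<close>] by blast
  obtain y where y: "w = S *v y" using invertible_mult_vec_surj[OF S] .
  have g: "g = l *\<^sub>R w - C *v w" using h by (simp add: algebra_simps)
  define z where "z = (\<lambda>i. l * \<sigma> $ i - \<tau> $ i)"
  have d: "(transpose S *v g) $ i = z i * y $ i" for i
  proof -
    have "transpose S *v g = l *\<^sub>R ((transpose S ** S) *v y) - (transpose S ** C ** S) *v y"
      by (simp only: g y matrix_vector_mult_diff_distrib matrix_vector_mult_scaleR matrix_vector_mul_assoc matrix_mul_assoc)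
    then have "(transpose S *v g) $ i = l * (\<sigma> $ i * y $ i) - \<tau> $ i * y $ i"
      unfolding \<sigma> \<tau> diag_mult_vec by simp
    then show ?thesis
      by (simp add: z_def algebra_simps)
  qed
  have z: "0 \<le> z i" for i
  proof -
    have "(S *v axis i 1) \<bullet> (S *v axis i 1) = \<sigma> $ i"
      "(S *v axis i 1) \<bullet> (C *v (S *v axis i 1)) = \<tau> $ i"
      using inner_congruence_diag_axis[of S "mat 1" \<sigma> i] inner_congruence_diag_axis[OF \<tau>, of i] \<sigma>
      by simp_all
    with le[of "S *v axis i 1"] show ?thesis by (simp add: z_def)
  qed
  define t :: "real^'n" where "t = (\<chi> i. z i * (y $ i)\<^sup>2)"
  have ww: "w \<bullet> w = (\<Sum>i\<in>UNIV. \<sigma> $ i * (y $ i)\<^sup>2)"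
    using inner_congruence_diag[of S "mat 1" \<sigma> y] \<sigma> by (simp add: y)
  have wCw: "w \<bullet> (C *v w) = (\<Sum>i\<in>UNIV. \<tau> $ i * (y $ i)\<^sup>2)"
    using inner_congruence_diag[OF \<tau>, of y] by (simp add: y)
  have "w \<bullet> (C *v w) + 2 * (g \<bullet> w) = l * (w \<bullet> w) - w \<bullet> (C *v w) + l * (w \<bullet> w)"
    by (simp add: g inner_diff_left inner_commute algebra_simps)
  also have "l * (w \<bullet> w) - w \<bullet> (C *v w) = 1 \<bullet> t"
    unfolding ww wCw by (simp add: inner_vec_def t_def z_def sum_distrib_left sum_subtractf algebra_simps)
  also have "w \<bullet> w = \<gamma>\<^sup>2"
    using w by (simp flip: power2_norm_eq_inner)
  finally have "w \<bullet> (C *v w) + 2 * (g \<bullet> w) = 1 \<bullet> t + \<gamma>\<^sup>2 * l"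
    by (simp add: mult_ac)
  moreover have "((transpose S *v g) $ i, t $ i, l * \<sigma> $ i - \<tau> $ i) \<in> cone_Q" for i
  proof -
    have "l * \<sigma> $ i - \<tau> $ i = z i" by (simp add: z_def)
    then show ?thesis
      unfolding d using z[of i] by (simp add: cone_Q_iff t_def power2_eq_square mult_ac)
  qed
  ultimately show thesis
    using w \<open>l \<ge> 0\<close> by (intro that)
qed

section \<open>The min-max problem and its conic form\<close>

text \<open>
  The common pattern of both reformulations: a problem over \<open>Z\<close> lifts the one over \<open>X\<close> if each
  lifted point overestimates the value of its projection and, over each point of \<open>X\<close>, some lifted
  point attains the value exactly, up to a constant \<open>K\<close>.
\<close>

lemma lifted_minimization:
  fixes f :: "'a \<Rightarrow> ereal" and g :: "'b \<Rightarrow> real"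
  assumes lower: "\<And>z. z \<in> Z \<Longrightarrow> \<pi> z \<in> X \<and> f (\<pi> z) \<le> ereal (g z + K)"
    and attained: "\<And>u. u \<in> X \<Longrightarrow> \<exists>z\<in>Z. \<pi> z = u \<and> f u = ereal (g z + K)"
  shows "optimal_value f X = optimal_value (\<lambda>z. ereal (g z)) Z + ereal K" (is ?val)
    and "is_arg_min f (\<lambda>u. u \<in> X) u \<longleftrightarrow> (\<exists>z. \<pi> z = u \<and> is_arg_min g (\<lambda>z. z \<in> Z) z)" (is ?arg)
    and "u \<in> X \<and> f u \<le> ereal s \<longleftrightarrow> (\<exists>z\<in>Z. \<pi> z = u \<and> g z + K \<le> s)" (is ?epi)
proof -
  have "optimal_value (\<lambda>z. ereal (g z)) Z + ereal K = (INF z\<in>Z. ereal (g z + K))"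
  proof (cases "Z = {}")
    case True
    then show ?thesis by (simp add: optimal_value_def top_ereal_def)
  next
    case False
    have "(INF z\<in>Z. ereal (g z) + ereal K) = (INF z\<in>Z. ereal (g z)) + ereal K"
    proof (rule antisym)
      have "(INF z\<in>Z. ereal (g z) + ereal K) - ereal K \<le> (INF z\<in>Z. ereal (g z))"
      proof (rule INF_greatest)
        fix z assume "z \<in> Z"
        then have "(INF z\<in>Z. ereal (g z) + ereal K) \<le> ereal (g z) + ereal K"
          by (rule INF_lower)
        then show "(INF z\<in>Z. ereal (g z) + ereal K) - ereal K \<le> ereal (g z)"
          by (simp add: ereal_minus_le del: plus_ereal.simps)
      qed
      then show "(INF z\<in>Z. ereal (g z) + ereal K) \<le> (INF z\<in>Z. ereal (g z)) + ereal K"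
        by (simp add: ereal_minus_le)
      show "(INF z\<in>Z. ereal (g z)) + ereal K \<le> (INF z\<in>Z. ereal (g z) + ereal K)"
        by (intro INF_greatest add_right_mono INF_lower)
    qed
    then show ?thesis by (simp add: optimal_value_def)
  qed
  moreover have "optimal_value f X = (INF z\<in>Z. ereal (g z + K))"
    unfolding optimal_value_def
  proof (rule antisym)
    show "(INF v\<in>X. f v) \<le> (INF z\<in>Z. ereal (g z + K))"
    proof (rule INF_greatest)
      fix z assume "z \<in> Z"
      then show "(INF v\<in>X. f v) \<le> ereal (g z + K)"
        using lower[of z] by (intro INF_lower2[of "\<pi> z"]) auto
    qed
    show "(INF z\<in>Z. ereal (g z + K)) \<le> (INF v\<in>X. f v)"
    proof (rule INF_greatest)
      fix v assume "v \<in> X"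
      then obtain z where "z \<in> Z" "f v = ereal (g z + K)" using attained by blast
      then show "(INF z\<in>Z. ereal (g z + K)) \<le> f v"
        using INF_lower[of z Z "\<lambda>z. ereal (g z + K)"] by simp
    qed
  qed
  ultimately show ?val by simp
  show ?epi
  proof
    assume "u \<in> X \<and> f u \<le> ereal s"
    then show "\<exists>z\<in>Z. \<pi> z = u \<and> g z + K \<le> s"
      using attained[of u] by auto
  next
    assume "\<exists>z\<in>Z. \<pi> z = u \<and> g z + K \<le> s"
    then obtain z where z: "z \<in> Z" "\<pi> z = u" "g z + K \<le> s" by blast
    then show "u \<in> X \<and> f u \<le> ereal s"
      using lower[of z] by (auto intro: order_trans)
  qed
  show ?arg
  proof
    assume u: "is_arg_min f (\<lambda>u. u \<in> X) u"
    then obtain z where z: "z \<in> Z" "\<pi> z = u" "f u = ereal (g z + K)"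
      using attained by (auto simp: is_arg_min_def)
    have "\<not> g z' < g z" if "z' \<in> Z" for z'
    proof
      assume "g z' < g z"
      then have "ereal (g z' + K) < f u" by (simp add: z)
      with lower[OF that] have "f (\<pi> z') < f u" by (auto intro: le_less_trans)
      then show False using u lower[OF that] by (auto simp: is_arg_min_def)
    qed
    with z show "\<exists>z. \<pi> z = u \<and> is_arg_min g (\<lambda>z. z \<in> Z) z"
      by (auto simp: is_arg_min_def)
  next
    assume "\<exists>z. \<pi> z = u \<and> is_arg_min g (\<lambda>z. z \<in> Z) z"
    then obtain z where z: "z \<in> Z" "\<pi> z = u" "\<And>z'. z' \<in> Z \<Longrightarrow> g z \<le> g z'"
      by (auto simp: is_arg_min_def not_less)
    have "\<not> f v < f u" if v: "v \<in> X" for v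
    proof -
      obtain z' where z': "z' \<in> Z" "f v = ereal (g z' + K)" using attained[OF v] by blast
      have "f u \<le> ereal (g z + K)" using lower[of z] z by simp
      also have "\<dots> \<le> f v" using z(3)[OF z'(1)] by (simp add: z')
      finally show ?thesis by simp
    qed
    then show "is_arg_min f (\<lambda>u. u \<in> X) u"
      using lower[of z] z by (auto simp: is_arg_min_def)
  qed
qed

lemma sym_pos_semidef_congruence:
  fixes M :: "real^'n^'m" and Q :: "real^'m^'m"
  assumes "sym_pos_semidef Q"
  shows "sym_pos_semidef (transpose M ** Q ** M)"
proof -
  have "x \<bullet> ((transpose M ** Q ** M) *v x) = (M *v x) \<bullet> (Q *v (M *v x))" for x
    by (metis matrix_vector_mul_assoc transpose_inner inner_commute)
  then show ?thesis
    using assms by (simp add: sym_pos_semidef_def matrix_transpose_mul matrix_mul_assoc)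
qed

lemma sym_pos_semidef_add:
  "sym_pos_semidef M \<Longrightarrow> sym_pos_semidef N \<Longrightarrow> sym_pos_semidef (M + N)"
  by (simp add: sym_pos_semidef_def matrix_vector_mult_add_rdistrib inner_add_right
      transpose_def vec_eq_iff)

lemma sym_pos_semidef_blkdiag:
  assumes "\<And>k. k < CARD('t) \<Longrightarrow> sym_pos_semidef (M k)"
  shows "sym_pos_semidef (blkdiag M :: real^('t::{finite,linorder} \<times> 'n::finite)^('t \<times> 'n))"
  using assms
  by (auto simp: sym_pos_semidef_def transpose_blkdiag inner_stacked block_blkdiag intro!: sum_nonneg)

lemma sym_pos_def_imp_semidef: "sym_pos_def M \<Longrightarrow> sym_pos_semidef M"
  unfolding sym_pos_def_def sym_pos_semidef_def by (metis inner_zero_left less_imp_le order_refl)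

abbreviation (input) initial_cost :: "'t::{finite,linorder} itself \<Rightarrow>
    ('x::finite, 'u::finite, 'w::finite) lq_system \<Rightarrow> real^'x \<Rightarrow> real" where
  "initial_cost T P x0 \<equiv> 2 * (vec_a T P \<bullet> x0) + x0 \<bullet> (bigA T P *v x0)"

locale convex_lq_system =
  fixes P :: "('x::finite, 'u::finite, 'w::finite) lq_system" and horizon :: "'t::{finite,linorder} itself"
  assumes Q: "\<And>k. k \<in> {1..CARD('t)} \<Longrightarrow> sym_pos_semidef (cost_Q P k)"
    and R: "\<And>k. k < CARD('t) \<Longrightarrow> sym_pos_def (cost_R P k)"
begin

lemma sym_pos_semidef_Qbar: "sym_pos_semidef (Qbar P :: real^('t \<times> 'x)^('t \<times> 'x))"
  unfolding Qbar_def by (rule sym_pos_semidef_blkdiag) (simp add: Q)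

lemma sym_pos_semidef_bigC: "sym_pos_semidef (bigC P :: real^('t \<times> 'w)^('t \<times> 'w))"
  unfolding bigC_def by (rule sym_pos_semidef_congruence[OF sym_pos_semidef_Qbar])

lemma sym_pos_semidef_bigB: "sym_pos_semidef (bigB P :: real^('t \<times> 'u)^('t \<times> 'u))"
  unfolding bigB_def Rbar_def
  by (intro sym_pos_semidef_add sym_pos_semidef_congruence sym_pos_semidef_Qbar
      sym_pos_semidef_blkdiag sym_pos_def_imp_semidef R)

lemma exists_diagonalizes:
  "\<exists>(S :: real^('t \<times> 'w)^('t \<times> 'w)) \<sigma> \<tau>. diagonalizes P S \<sigma> \<tau>"
proof -
  obtain S :: "real^('t \<times> 'w)^('t \<times> 'w)" and \<tau>
    where S: "orthogonal_matrix S" "transpose S ** bigC P ** S = diag \<tau>"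
    using symmetric_matrix_orthogonally_diagonalizable sym_pos_semidef_bigC
    unfolding sym_pos_semidef_def by metis
  moreover have "diag 1 = (mat 1 :: real^('t \<times> 'w)^('t \<times> 'w))"
    by (simp add: diag_def mat_def vec_eq_iff)
  ultimately have "diagonalizes P S 1 \<tau>"
    unfolding diagonalizes_def orthogonal_matrix_def invertible_def by metis
  then show ?thesis by blast
qed

lemma cost_J_expand:
  "cost_J P x0 u w =
    w \<bullet> (bigC P *v w) + 2 * ((vec_c P x0 + transpose (bigD P) *v u) \<bullet> w)
    + u \<bullet> (bigB P *v u) + 2 * (vec_b P x0 \<bullet> u)
    + 2 * (vec_a TYPE('t) P \<bullet> x0) + x0 \<bullet> (bigA TYPE('t) P *v x0)"
  for u :: "real^('t \<times> 'u)"
  by (rule cost_J_compact) (use Q in \<open>simp add: sym_pos_semidef_def\<close>)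

lemma worst_case_le_R_objective:
  fixes u :: "real^('t \<times> 'u)"
  assumes S: "diagonalizes P S \<sigma> \<tau>" and z: "(u, l, t) \<in> R_feasible P x0 U S \<sigma> \<tau>"
  shows "worst_case P x0 \<gamma> u \<le> ereal (R_objective P x0 \<gamma> (u, l, t) + initial_cost TYPE('t) P x0)"
  unfolding worst_case_def
proof (rule SUP_least)
  fix w :: "real^('t \<times> 'w)" assume "w \<in> disturbances \<gamma>"
  then have "w \<bullet> (bigC P *v w) + 2 * ((vec_c P x0 + transpose (bigD P) *v u) \<bullet> w)
      \<le> 1 \<bullet> t + \<gamma>\<^sup>2 * l"
    using S z unfolding diagonalizes_def R_feasible_def disturbances_def
    by (intro ball_quadratic_weak_duality[of S \<sigma> _ \<tau>]) auto
  then show "ereal (cost_J P x0 u w) \<le> ereal (R_objective P x0 \<gamma> (u, l, t) + initial_cost TYPE('t) P x0)"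
    by (simp add: cost_J_expand R_objective_def)
qed

text \<open>
  The point on the sphere of radius \<open>\<gamma>\<close> provided by strong duality is a worst disturbance, because
  its cost reaches the bound of weak duality.
\<close>

lemma worst_case_eq_R_objective:
  fixes u :: "real^('t \<times> 'u)"
  assumes S: "diagonalizes P S \<sigma> \<tau>" and "\<gamma> > 0" and "u \<in> U"
  shows "\<exists>l t. (u, l, t) \<in> R_feasible P x0 U S \<sigma> \<tau> \<and>
    worst_case P x0 \<gamma> u = ereal (R_objective P x0 \<gamma> (u, l, t) + initial_cost TYPE('t) P x0)"
proof -
  let ?g = "vec_c P x0 + transpose (bigD P) *v u"
  obtain w l t where w: "norm w = \<gamma>" and feas: "0 \<le> l"
    "\<And>i. ((transpose S *v ?g) $ i, t $ i, l * \<sigma> $ i - \<tau> $ i) \<in> cone_Q"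
    and eq: "w \<bullet> (bigC P *v w) + 2 * (?g \<bullet> w) = 1 \<bullet> t + \<gamma>\<^sup>2 * l"
    using ball_quadratic_strong_duality[OF sym_pos_semidef_bigC \<open>\<gamma> > 0\<close>, of S \<sigma> \<tau> ?g] S
    unfolding diagonalizes_def by blast
  have z: "(u, l, t) \<in> R_feasible P x0 U S \<sigma> \<tau>"
    unfolding R_feasible_def using feas \<open>u \<in> U\<close> by blast
  let ?v = "ereal (R_objective P x0 \<gamma> (u, l, t) + initial_cost TYPE('t) P x0)"
  have "?v = ereal (cost_J P x0 u w)"
    using eq by (simp add: cost_J_expand R_objective_def)
  also have "\<dots> \<le> worst_case P x0 \<gamma> u"
    unfolding worst_case_def using w by (intro SUP_upper) (simp add: disturbances_def)
  finally have "worst_case P x0 \<gamma> u = ?v"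
    using worst_case_le_R_objective[OF S z, of \<gamma>] by (intro antisym)
  with z show ?thesis by blast
qed

lemma R_lower:
  fixes z :: "(real^('t \<times> 'u)) \<times> real \<times> (real^('t \<times> 'w))"
  assumes "diagonalizes P S \<sigma> \<tau>" and "z \<in> R_feasible P x0 U S \<sigma> \<tau>"
  shows "fst z \<in> U \<and> worst_case P x0 \<gamma> (fst z) \<le> ereal (R_objective P x0 \<gamma> z + initial_cost TYPE('t) P x0)"
proof -
  obtain u l t where z: "z = (u, l, t)" by (cases z)
  then have "u \<in> U" using assms(2) by (simp add: R_feasible_def)
  then show ?thesis
    using worst_case_le_R_objective[OF assms[unfolded z], of \<gamma>] by (simp only: z fst_conv)
qed

lemma R_attained:
  fixes u :: "real^('t \<times> 'u)"
  assumes "diagonalizes P S \<sigma> \<tau>" and "\<gamma> > 0" and "u \<in> U"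
  shows "\<exists>z\<in>R_feasible P x0 U S \<sigma> \<tau>. fst z = u \<and>
    worst_case P x0 \<gamma> u = ereal (R_objective P x0 \<gamma> z + initial_cost TYPE('t) P x0)"
  using worst_case_eq_R_objective[OF assms] by force

lemma worst_case_minimization_via_R:
  fixes S :: "real^('t \<times> 'w)^('t \<times> 'w)" and U :: "(real^('t \<times> 'u)) set" and x0 :: "real^'x"
  assumes S: "diagonalizes P S \<sigma> \<tau>" and "\<gamma> > 0"
  defines "F \<equiv> R_feasible P x0 U S \<sigma> \<tau>"
  shows "optimal_value (worst_case P x0 \<gamma>) U =
      optimal_value (\<lambda>z. ereal (R_objective P x0 \<gamma> z)) F + ereal (initial_cost TYPE('t) P x0)"
    and "is_arg_min (worst_case P x0 \<gamma>) (\<lambda>u. u \<in> U) u \<longleftrightarrow>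
      (\<exists>l t. is_arg_min (R_objective P x0 \<gamma>) (\<lambda>z. z \<in> F) (u, l, t))"
    and "u \<in> U \<and> worst_case P x0 \<gamma> u \<le> ereal s \<longleftrightarrow>
      (\<exists>l t. (u, l, t) \<in> F \<and> R_objective P x0 \<gamma> (u, l, t) + initial_cost TYPE('t) P x0 \<le> s)"
proof -
  have ex: "(\<exists>z. fst z = u \<and> \<Psi> z) \<longleftrightarrow> (\<exists>l t. \<Psi> (u, l, t))" for \<Psi> :: "_ \<times> real \<times> (real^('t \<times> 'w)) \<Rightarrow> bool"
    by force
  note lift = lifted_minimization[where \<pi> = fst and X = U and Z = F and f = "worst_case P x0 \<gamma>"
      and g = "R_objective P x0 \<gamma>" and K = "initial_cost TYPE('t) P x0",
      unfolded F_def, OF R_lower[OF S] R_attained[OF S \<open>\<gamma> > 0\<close>], folded F_def]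
  show "optimal_value (worst_case P x0 \<gamma>) U =
      optimal_value (\<lambda>z. ereal (R_objective P x0 \<gamma> z)) F + ereal (initial_cost TYPE('t) P x0)"
    by (rule lift(1))
  show "is_arg_min (worst_case P x0 \<gamma>) (\<lambda>u. u \<in> U) u \<longleftrightarrow>
      (\<exists>l t. is_arg_min (R_objective P x0 \<gamma>) (\<lambda>z. z \<in> F) (u, l, t))"
    unfolding ex[symmetric] by (rule lift(2))
  show "u \<in> U \<and> worst_case P x0 \<gamma> u \<le> ereal s \<longleftrightarrow>
      (\<exists>l t. (u, l, t) \<in> F \<and> R_objective P x0 \<gamma> (u, l, t) + initial_cost TYPE('t) P x0 \<le> s)"
    using lift(3)[of u s] ex[of "\<lambda>z. z \<in> F \<and> R_objective P x0 \<gamma> z + initial_cost TYPE('t) P x0 \<le> s"]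
    by (metis (no_types, lifting))
qed

end

section \<open>Building second-order cone programs\<close>

text \<open>
  Constraints on \<open>n\<close> real variables are assembled as predicates closed under conjunction; all
  bookkeeping of coefficients and row numbers is confined to the closure lemmas.
\<close>

definition affine_in :: "nat \<Rightarrow> ((nat \<Rightarrow> real) \<Rightarrow> real) \<Rightarrow> bool" where
  "affine_in n f \<longleftrightarrow> (\<exists>c d. \<forall>x. f x = rdot n c x + d)"

definition soc_expressible :: "nat \<Rightarrow> ((nat \<Rightarrow> real) \<Rightarrow> bool) \<Rightarrow> bool" where
  "soc_expressible n \<Phi> \<longleftrightarrow> (\<exists>Ks. \<forall>x. \<Phi> x \<longleftrightarrow> (\<forall>K\<in>set Ks. soc_satisfied n K x))"

lemma affine_in_const: "affine_in n (\<lambda>x. d)"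
  unfolding affine_in_def by (rule exI[of _ "\<lambda>_. 0"]) (auto simp: rdot_def)

lemma affine_in_add:
  assumes "affine_in n f" and "affine_in n g"
  shows "affine_in n (\<lambda>x. f x + g x)"
proof -
  obtain c d c' d' where "\<forall>x. f x = rdot n c x + d" "\<forall>x. g x = rdot n c' x + d'"
    using assms unfolding affine_in_def by blast
  then have "\<forall>x. f x + g x = rdot n (\<lambda>j. c j + c' j) x + (d + d')"
    by (simp add: rdot_def sum.distrib distrib_right)
  then show ?thesis unfolding affine_in_def by (intro exI)
qed

lemma affine_in_scale:
  assumes "affine_in n f"
  shows "affine_in n (\<lambda>x. a * f x)"
proof -
  obtain c d where "\<forall>x. f x = rdot n c x + d"
    using assms unfolding affine_in_def by blast
  then have "\<forall>x. a * f x = rdot n (\<lambda>j. a * c j) x + a * d"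
    by (simp add: rdot_def sum_distrib_left distrib_left mult.assoc)
  then show ?thesis unfolding affine_in_def by (intro exI)
qed

lemma affine_in_diff:
  assumes "affine_in n f" and "affine_in n g"
  shows "affine_in n (\<lambda>x. f x - g x)"
  using affine_in_add[OF assms(1) affine_in_scale[OF assms(2), of "-1"]] by simp

lemma affine_in_coord:
  assumes "j < n"
  shows "affine_in n (\<lambda>x. x j)"
proof -
  have "x j = rdot n (\<lambda>i. if i = j then 1 else 0) x + 0" for x
    using assms by (simp add: rdot_def if_distrib[of "\<lambda>a. a * _"] cong: if_cong)
  then show ?thesis unfolding affine_in_def by blast
qed

lemma affine_in_sum:
  assumes "\<And>i. i \<in> I \<Longrightarrow> affine_in n (f i)"
  shows "affine_in n (\<lambda>x. \<Sum>i\<in>I. f i x)"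
  using assms
  by (induction I rule: infinite_finite_induct) (auto intro: affine_in_const affine_in_add)

lemma affine_in_rdot:
  assumes "m \<le> n"
  shows "affine_in n (rdot m c)"
  unfolding rdot_def[abs_def] using assms
  by (intro affine_in_sum affine_in_scale affine_in_coord) simp

lemma affine_in_inner_proj:
  assumes "range p \<subseteq> {..<n}"
  shows "affine_in n (\<lambda>x. a \<bullet> proj p x)"
  unfolding inner_vec_def proj_def using assms
  by (auto intro!: affine_in_sum affine_in_scale affine_in_coord)

lemma affine_in_mult_vec_proj:
  assumes "range p \<subseteq> {..<n}"
  shows "affine_in n (\<lambda>x. (A *v proj p x) $ i)"
  using affine_in_inner_proj[OF assms, of "row i A"]
  by (simp add: matrix_vector_mul_component row_def)

lemmas affine_in_intros = affine_in_const affine_in_add affine_in_diff affine_in_scale affine_in_coord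
  affine_in_rdot affine_in_inner_proj affine_in_mult_vec_proj

lemma soc_expressible_conj:
  assumes "soc_expressible n \<Phi>" and "soc_expressible n \<Psi>"
  shows "soc_expressible n (\<lambda>x. \<Phi> x \<and> \<Psi> x)"
proof -
  obtain Ks Ls where "\<forall>x. \<Phi> x \<longleftrightarrow> (\<forall>K\<in>set Ks. soc_satisfied n K x)"
    "\<forall>x. \<Psi> x \<longleftrightarrow> (\<forall>K\<in>set Ls. soc_satisfied n K x)"
    using assms unfolding soc_expressible_def by blast
  then have "\<forall>x. (\<Phi> x \<and> \<Psi> x) \<longleftrightarrow> (\<forall>K\<in>set (Ks @ Ls). soc_satisfied n K x)"
    by auto
  then show ?thesis unfolding soc_expressible_def by (rule exI)
qed

lemma soc_expressible_True: "soc_expressible n (\<lambda>x. True)"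
  unfolding soc_expressible_def by (rule exI[of _ "[]"]) simp

lemma soc_expressible_ball:
  assumes "finite I" and "\<And>i. i \<in> I \<Longrightarrow> soc_expressible n (\<Phi> i)"
  shows "soc_expressible n (\<lambda>x. \<forall>i\<in>I. \<Phi> i x)"
  using assms
  by (induction I rule: finite_induct) (auto intro: soc_expressible_True soc_expressible_conj)

lemma soc_expressible_norm_le:
  assumes "finite I" and "\<And>i. i \<in> I \<Longrightarrow> affine_in n (f i)" and "affine_in n g"
  shows "soc_expressible n (\<lambda>x. L2_set (\<lambda>i. f i x) I \<le> g x)"
proof -
  have "\<forall>i. \<exists>c d. i \<in> I \<longrightarrow> (\<forall>x. f i x = rdot n c x + d)"
    using assms(2) unfolding affine_in_def by blast
  then obtain c d where f: "\<And>i x. i \<in> I \<Longrightarrow> f i x = rdot n (c i) x + d i"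
    by metis
  obtain c' d' where g: "\<And>x. g x = rdot n c' x + d'"
    using assms(3) unfolding affine_in_def by blast
  obtain e where e: "bij_betw e {..<card I} I"
    using ex_bij_betw_nat_finite[OF assms(1)] by (auto simp: atLeast0LessThan)
  define K where "K = \<lparr>cone_rows = card I, cone_mat = \<lambda>k. c (e k), cone_off = \<lambda>k. d (e k),
    cone_lin = c', cone_const = d'\<rparr>"
  have "L2_set (\<lambda>i. f i x) I = L2_set (\<lambda>k. rdot n (c (e k)) x + d (e k)) {..<card I}" for x
  proof -
    have "(\<Sum>i\<in>I. (f i x)\<^sup>2) = (\<Sum>k<card I. (f (e k) x)\<^sup>2)"
      by (rule sum.reindex_bij_betw[OF e, symmetric])
    also have "\<dots> = (\<Sum>k<card I. (rdot n (c (e k)) x + d (e k))\<^sup>2)"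
      using e by (intro sum.cong) (auto simp: f bij_betw_apply)
    finally show ?thesis by (simp add: L2_set_def)
  qed
  then have "(L2_set (\<lambda>i. f i x) I \<le> g x) = (\<forall>K\<in>set [K]. soc_satisfied n K x)" for x
    by (simp add: soc_satisfied_def K_def g)
  then show ?thesis unfolding soc_expressible_def by blast
qed

lemma soc_expressible_le:
  assumes "affine_in n f" and "affine_in n g"
  shows "soc_expressible n (\<lambda>x. f x \<le> g x)"
  using soc_expressible_norm_le[of "{}" n "\<lambda>_. f" "\<lambda>x. g x - f x"] affine_in_diff[OF assms(2,1)]
  by (simp add: L2_set_def)

lemma soc_expressible_eq:
  assumes "affine_in n f" and "affine_in n g"
  shows "soc_expressible n (\<lambda>x. f x = g x)"
  using soc_expressible_conj[OF soc_expressible_le[OF assms] soc_expressible_le[OF assms(2,1)]]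
  by (simp add: eq_iff)

lemma soc_expressible_soc_satisfied:
  assumes "m \<le> n"
  shows "soc_expressible n (soc_satisfied m K)"
  unfolding soc_satisfied_def[abs_def] using assms
  by (intro soc_expressible_norm_le affine_in_intros) auto

lemma soc_expressible_cone_Q:
  assumes "affine_in n f" and "affine_in n g" and "affine_in n h"
  shows "soc_expressible n (\<lambda>x. (f x, g x, h x) \<in> cone_Q)"
proof -
  have "soc_expressible n (\<lambda>x. L2_set (\<lambda>b. (if b then \<lambda>x. 2 * f x else (\<lambda>x. g x - h x)) x) UNIV \<le> g x + h x)"
    using assms by (intro soc_expressible_norm_le) (auto intro!: affine_in_intros)
  then show ?thesis
    by (simp add: cone_Q_def norm_Pair L2_set_def UNIV_bool add.commute)
qed

text \<open>
  A convex quadratic inequality is conic because \<open>4 * q + (g - 1)\<^sup>2 \<le> (g + 1)\<^sup>2\<close> means \<open>q \<le> g\<close>.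
  The index \<open>None\<close> carries the additional entry \<open>g - 1\<close> of the norm.
\<close>

lemma soc_expressible_sum_squares_le:
  fixes f :: "'k::finite \<Rightarrow> (nat \<Rightarrow> real) \<Rightarrow> real"
  assumes "\<And>i. affine_in n (f i)" and "affine_in n g"
  shows "soc_expressible n (\<lambda>x. (\<Sum>i\<in>UNIV. (f i x)\<^sup>2) \<le> g x)"
proof -
  let ?F = "\<lambda>i x. case i of None \<Rightarrow> g x - 1 | Some i \<Rightarrow> 2 * f i x"
  have "affine_in n (?F i)" for i
    using assms by (cases i) (auto intro!: affine_in_intros)
  then have "soc_expressible n (\<lambda>x. L2_set (\<lambda>i. ?F i x) UNIV \<le> g x + 1)"
    using assms by (intro soc_expressible_norm_le affine_in_intros) auto
  moreover have "L2_set (\<lambda>i. ?F i x) UNIV \<le> g x + 1 \<longleftrightarrow> (\<Sum>i\<in>UNIV. (f i x)\<^sup>2) \<le> g x" for x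
  proof -
    let ?q = "\<Sum>i\<in>UNIV. (f i x)\<^sup>2"
    have "(\<Sum>i\<in>UNIV. (?F i x)\<^sup>2) = (g x - 1)\<^sup>2 + 4 * ?q"
      by (simp add: UNIV_option_conv sum.reindex sum_distrib_left power_mult_distrib)
    also have "\<dots> = (g x + 1)\<^sup>2 + 4 * (?q - g x)"
      by (simp add: power2_eq_square algebra_simps)
    finally have L: "L2_set (\<lambda>i. ?F i x) UNIV = sqrt ((g x + 1)\<^sup>2 + 4 * (?q - g x))"
      by (simp add: L2_set_def)
    have "?q \<ge> 0" by (simp add: sum_nonneg)
    show ?thesis
    proof
      assume "L2_set (\<lambda>i. ?F i x) UNIV \<le> g x + 1"
      then show "?q \<le> g x" unfolding L using sqrt_le_D by fastforce
    next
      assume "?q \<le> g x"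
      then show "L2_set (\<lambda>i. ?F i x) UNIV \<le> g x + 1"
        unfolding L using \<open>?q \<ge> 0\<close> by (intro real_le_lsqrt) auto
    qed
  qed
  ultimately show ?thesis by simp
qed

definition truncate :: "nat \<Rightarrow> (nat \<Rightarrow> real) \<Rightarrow> nat \<Rightarrow> real" where
  "truncate m x = (\<lambda>j. if j < m then x j else 0)"

lemma rdot_truncate [simp]: "rdot m c (truncate m x) = rdot m c x"
  by (simp add: rdot_def truncate_def)

lemma truncate_in_rvecs: "truncate m x \<in> rvecs m"
  by (simp add: rvecs_def truncate_def)

lemma proj_truncate:
  "range p \<subseteq> {..<m} \<Longrightarrow> proj p (truncate m x) = proj p x"
  by (auto simp: proj_def truncate_def vec_eq_iff)

text \<open>
  Embeds the constraints of a given system into one with more variables.  Truncation is needed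
  because the points of the smaller system vanish beyond its own variables.
\<close>

lemma soc_expressible_soc_feasible:
  assumes "num_vars Z \<le> n"
  shows "soc_expressible n (\<lambda>x. truncate (num_vars Z) x \<in> soc_feasible Z)"
proof -
  let ?m = "num_vars Z"
  have "soc_expressible n (\<lambda>x. (\<forall>K\<in>set (cones Z). soc_satisfied ?m K x) \<and>
      (\<forall>i\<in>{..<eq_rows Z}. rdot ?m (eq_mat Z i) x = eq_rhs Z i))"
    using assms by (intro soc_expressible_conj soc_expressible_ball soc_expressible_soc_satisfied
        soc_expressible_eq affine_in_intros) auto
  moreover have "truncate ?m x \<in> soc_feasible Z \<longleftrightarrow> (\<forall>K\<in>set (cones Z). soc_satisfied ?m K x) \<and>
      (\<forall>i\<in>{..<eq_rows Z}. rdot ?m (eq_mat Z i) x = eq_rhs Z i)" for x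
    by (auto simp: soc_feasible_def soc_satisfied_def truncate_in_rvecs)
  ultimately show ?thesis by simp
qed

lemma polyhedron_imp_soc_representable:
  fixes U :: "(real^'n) set"
  assumes "polyhedron U"
  shows "soc_representable U"
proof -
  obtain F where F: "finite F" "U = \<Inter>F" "\<forall>h\<in>F. \<exists>a b. a \<noteq> 0 \<and> h = {x. a \<bullet> x \<le> b}"
    using assms unfolding polyhedron_def by blast
  then have "\<forall>h. \<exists>a b. h \<in> F \<longrightarrow> h = {x. a \<bullet> x \<le> b}" by blast
  then obtain a b where ab: "\<And>h. h \<in> F \<Longrightarrow> h = {x. a h \<bullet> x \<le> b h}" by metis
  obtain p :: "'n \<Rightarrow> nat" where p: "bij_betw p UNIV {..<CARD('n)}"
    using ex_bij_betw_finite_nat[of "UNIV :: 'n set"] by (auto simp: atLeast0LessThan)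
  have range: "range p = {..<CARD('n)}" and "inj p" using p by (auto simp: bij_betw_def)
  have "soc_expressible CARD('n) (\<lambda>x. \<forall>h\<in>F. a h \<bullet> proj p x \<le> b h)"
    using F range by (intro soc_expressible_ball soc_expressible_le affine_in_intros) auto
  moreover have "(\<forall>h\<in>F. a h \<bullet> proj p x \<le> b h) \<longleftrightarrow> proj p x \<in> U" for x
    using F(2) ab by blast
  ultimately obtain Ks where Ks: "\<And>x. proj p x \<in> U \<longleftrightarrow> (\<forall>K\<in>set Ks. soc_satisfied CARD('n) K x)"
    unfolding soc_expressible_def by auto
  define Z :: soc_system where "Z = \<lparr>num_vars = CARD('n), cones = Ks, eq_rows = 0,
    eq_mat = \<lambda>_ _. 0, eq_rhs = \<lambda>_. 0\<rparr>"
  have feas: "soc_feasible Z = {x \<in> rvecs CARD('n). proj p x \<in> U}"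
    by (auto simp: soc_feasible_def Z_def Ks)
  have "v \<in> proj p ` soc_feasible Z" if "v \<in> U" for v
  proof
    let ?x = "truncate CARD('n) (\<lambda>j. v $ inv p j)"
    show "v = proj p ?x"
      using range \<open>inj p\<close> by (simp add: proj_truncate) (simp add: proj_def vec_eq_iff)
    then show "?x \<in> soc_feasible Z"
      using that by (simp add: feas rvecs_def truncate_def)
  qed
  then have "U = proj p ` soc_feasible Z"
    by (auto simp: feas)
  moreover have "coord_selection (num_vars Z) p"
    using range \<open>inj p\<close> by (simp add: coord_selection_def Z_def)
  ultimately show ?thesis unfolding soc_representable_def by blast
qed

text \<open>
  If the epigraph of \<open>f\<close> over \<open>U\<close> is conic with auxiliary variables \<open>l\<close> and \<open>t\<close>, then minimizing
  \<open>f\<close> is a cone program.  Its variables are those representing \<open>U\<close>, followed by \<open>t\<close>, by \<open>l\<close> and by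
  the epigraph variable; the latter is the objective, which thereby is linear without a constant
  term even if \<open>f\<close> contains one.
\<close>

lemma socp_reformulation_of_epigraph:
  fixes U :: "(real^'n) set" and f :: "real^'n \<Rightarrow> ereal"
    and \<Phi> :: "real^'n \<Rightarrow> real \<Rightarrow> real^'k \<Rightarrow> real \<Rightarrow> bool"
  assumes U: "soc_representable U"
    and finite: "\<And>u. u \<in> U \<Longrightarrow> \<bar>f u\<bar> \<noteq> \<infinity>"
    and epi: "\<And>u s. u \<in> U \<Longrightarrow> f u \<le> ereal s \<longleftrightarrow> (\<exists>l t. \<Phi> u l t s)"
    and expressible: "\<And>n p q j e. range p \<subseteq> {..<n} \<Longrightarrow> range q \<subseteq> {..<n} \<Longrightarrow> j < n \<Longrightarrow> e < n \<Longrightarrow>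
      soc_expressible n (\<lambda>x. \<Phi> (proj p x) (x j) (proj q x) (x e))"
  shows "\<exists>Z p. socp_reformulation f U Z p"
proof -
  obtain Z0 :: soc_system and p where p: "coord_selection (num_vars Z0) p"
    and U_eq: "U = proj p ` soc_feasible Z0"
    using U unfolding soc_representable_def by blast
  obtain ix :: "'k \<Rightarrow> nat" where ix: "bij_betw ix UNIV {..<CARD('k)}"
    using ex_bij_betw_finite_nat[of "UNIV :: 'k set"] by (auto simp: atLeast0LessThan)
  have ix_less: "ix i < CARD('k)" for i using ix by (auto simp: bij_betw_def)
  have inv_ix: "inv ix (ix i) = i" for i using ix by (simp add: bij_betw_def)
  define n0 where "n0 = num_vars Z0"
  define j where "j = n0 + CARD('k)"
  define e where "e = Suc j"
  define n where "n = Suc e"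
  define q where "q = (\<lambda>i. n0 + ix i)"
  have p0: "range p \<subseteq> {..<n0}" "inj p" using p by (auto simp: coord_selection_def n0_def)
  have pn: "range p \<subseteq> {..<n}" using p0 by (auto simp: n_def e_def j_def)
  have qn: "range q \<subseteq> {..<n}"
    using ix_less by (auto simp: q_def n_def e_def j_def less_Suc_eq)
  have "soc_expressible n (\<lambda>x. truncate n0 x \<in> soc_feasible Z0 \<and> \<Phi> (proj p x) (x j) (proj q x) (x e))"
    unfolding n0_def by (intro soc_expressible_conj soc_expressible_soc_feasible expressible pn qn)
      (auto simp: n_def e_def j_def n0_def)
  then obtain Ks where Ks: "\<And>x. (\<forall>K\<in>set Ks. soc_satisfied n K x) \<longleftrightarrow>
      truncate n0 x \<in> soc_feasible Z0 \<and> \<Phi> (proj p x) (x j) (proj q x) (x e)"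
    unfolding soc_expressible_def by auto
  define Z :: socp where "Z = \<lparr>num_vars = n, cones = Ks, eq_rows = 0, eq_mat = \<lambda>_ _. 0,
    eq_rhs = \<lambda>_. 0, objective = \<lambda>i. if i = e then 1 else 0\<rparr>"
  have feas: "soc_feasible Z = {x \<in> rvecs n. truncate n0 x \<in> soc_feasible Z0 \<and>
      \<Phi> (proj p x) (x j) (proj q x) (x e)}"
    by (auto simp: soc_feasible_def Z_def Ks)
  have obj: "socp_objective Z x = x e" for x
    by (simp add: socp_objective_def Z_def rdot_def n_def if_distrib[of "\<lambda>a. a * _"] cong: if_cong)
  have lower: "proj p x \<in> U \<and> f (proj p x) \<le> ereal (socp_objective Z x + 0)"
    if "x \<in> soc_feasible Z" for x
  proof -
    have "proj p (truncate n0 x) \<in> U"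
      using that unfolding U_eq feas by blast
    then have "proj p x \<in> U" by (simp add: proj_truncate p0)
    then show ?thesis
      using that epi[of "proj p x" "x e"] by (auto simp: feas obj)
  qed
  have attained: "\<exists>x\<in>soc_feasible Z. proj p x = u \<and> f u = ereal (socp_objective Z x + 0)"
    if "u \<in> U" for u
  proof -
    obtain y where y: "y \<in> soc_feasible Z0" "u = proj p y" using \<open>u \<in> U\<close> U_eq by blast
    obtain s where s: "f u = ereal s" using finite[OF \<open>u \<in> U\<close>] by (cases "f u") auto
    then obtain l t where lt: "\<Phi> u l t s" using epi[OF \<open>u \<in> U\<close>, of s] by auto
    define x where "x = (\<lambda>i. if i < n0 then y i else if i < j then t $ inv ix (i - n0)
      else if i = j then l else if i = e then s else 0)"
    have "truncate n0 x = y"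
      using y(1) by (auto simp: truncate_def x_def soc_feasible_def rvecs_def n0_def)
    moreover from this have px: "proj p x = u"
      using y(2) proj_truncate[OF p0(1), of x] by simp
    moreover have "proj q x = t"
      using ix_less by (simp add: proj_def q_def x_def j_def inv_ix vec_eq_iff)
    moreover have "x j = l" "x e = s" "x \<in> rvecs n"
      by (auto simp: x_def j_def e_def n_def rvecs_def)
    ultimately have "x \<in> soc_feasible Z"
      using y lt by (simp add: feas)
    with px \<open>x e = s\<close> s show ?thesis by (auto simp: obj)
  qed
  have "coord_selection (num_vars Z) p"
    using pn p0 by (simp add: coord_selection_def Z_def)
  then have "socp_reformulation f U Z p"
    unfolding socp_reformulation_def
    using lifted_minimization[of "soc_feasible Z" "proj p" U f "socp_objective Z" 0, OF lower attained]
    by (simp add: zero_ereal_def[symmetric])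
  then show ?thesis by blast
qed

section \<open>The robust control problem as a second-order cone program\<close>

context convex_lq_system
begin

lemma worst_case_finite: "\<gamma> > 0 \<Longrightarrow> \<bar>worst_case P x0 \<gamma> u\<bar> \<noteq> \<infinity>" for u :: "real^('t \<times> 'u)"
  using worst_case_attained[of \<gamma> P x0 u] Q by (auto simp: sym_pos_semidef_def)

text \<open>
  The constraints of (R), together with the bound of its objective by the epigraph variable, are
  affine apart from the cones and the term \<open>u \<bullet> (bigB P *v u)\<close>, which is rewritten as a sum of
  squares.
\<close>

lemma exists_socp_reformulation:
  fixes U :: "(real^('t \<times> 'u)) set"
  assumes "\<gamma> > 0" and U: "soc_representable U"
  shows "\<exists>Z p. socp_reformulation (worst_case P x0 \<gamma>) U Z p"
proof -
  obtain S :: "real^('t \<times> 'w)^('t \<times> 'w)" and \<sigma> \<tau> where S: "diagonalizes P S \<sigma> \<tau>"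
    using exists_diagonalizes by blast
  obtain T :: "real^('t \<times> 'u)^('t \<times> 'u)"
    where T: "\<And>u. u \<bullet> (bigB P *v u) = (\<Sum>i\<in>UNIV. ((T *v u) $ i)\<^sup>2)"
    using sym_pos_semidef_sum_squares[OF sym_pos_semidef_bigB] by blast
  let ?cone = "\<lambda>u l t i. ((transpose S *v vec_c P x0) $ i + ((transpose S ** transpose (bigD P)) *v u) $ i,
     t $ i, l * \<sigma> $ i - \<tau> $ i) \<in> cone_Q"
  let ?\<Phi> = "\<lambda>u l t s. 0 \<le> l \<and> (\<forall>i\<in>UNIV. ?cone u l t i) \<and>
     (\<Sum>i\<in>UNIV. ((T *v u) $ i)\<^sup>2) \<le>
       s - 2 * (vec_b P x0 \<bullet> u) - 1 \<bullet> t - \<gamma>\<^sup>2 * l - initial_cost TYPE('t) P x0"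
  show ?thesis
  proof (rule socp_reformulation_of_epigraph[where \<Phi> = ?\<Phi>, OF U])
    show "\<bar>worst_case P x0 \<gamma> u\<bar> \<noteq> \<infinity>" for u :: "real^('t \<times> 'u)"
      by (rule worst_case_finite[OF \<open>\<gamma> > 0\<close>])
    show "worst_case P x0 \<gamma> u \<le> ereal s \<longleftrightarrow> (\<exists>l t. ?\<Phi> u l t s)" if "u \<in> U" for u s
    proof -
      have cone: "transpose S *v (vec_c P x0 + transpose (bigD P) *v u) =
          transpose S *v vec_c P x0 + (transpose S ** transpose (bigD P)) *v u"
        by (simp only: matrix_vector_right_distrib matrix_vector_mul_assoc)
      have \<Phi>: "(u, l, t) \<in> R_feasible P x0 U S \<sigma> \<tau> \<and>
          R_objective P x0 \<gamma> (u, l, t) + initial_cost TYPE('t) P x0 \<le> s \<longleftrightarrow> ?\<Phi> u l t s" for l t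
        unfolding R_feasible_def R_objective_def mem_Collect_eq prod.case cone T vector_add_component
        using \<open>u \<in> U\<close> by auto
      show ?thesis
        using worst_case_minimization_via_R(3)[OF S \<open>\<gamma> > 0\<close>, of u U x0 s] \<open>u \<in> U\<close> unfolding \<Phi> by simp
    qed
    show "soc_expressible n (\<lambda>x. ?\<Phi> (proj p x) (x j) (proj q x) (x e))"
      if "range p \<subseteq> {..<n}" "range q \<subseteq> {..<n}" "j < n" "e < n"
      for n j e and p :: "'t \<times> 'u \<Rightarrow> nat" and q :: "'t \<times> 'w \<Rightarrow> nat"
    proof -
      have t: "affine_in n (\<lambda>x. proj q x $ i)" for i
        using that by (auto simp: proj_def intro!: affine_in_coord)
      have l: "affine_in n (\<lambda>x. x j * a)" for a
        using affine_in_scale[OF affine_in_coord[OF \<open>j < n\<close>], of a] by (simp add: mult.commute)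
      show ?thesis
        using that by (intro soc_expressible_conj soc_expressible_ball soc_expressible_le
            soc_expressible_cone_Q soc_expressible_sum_squares_le affine_in_intros t l) auto
    qed
  qed
qed

end

theorem mainTheorem1:
  fixes P :: "('x::finite, 'u::finite, 'w::finite) lq_system"
    and x0 :: "real^'x"
    and \<gamma> :: real
    and U :: "(real^('t::{finite,linorder} \<times> 'u)) set"
  assumes "\<And>k. k \<in> {1..CARD('t)} \<Longrightarrow> sym_pos_semidef (cost_Q P k)"
    and "\<And>k. k < CARD('t) \<Longrightarrow> sym_pos_def (cost_R P k)"
    and "\<gamma> > 0"
    and "closed U" and "convex U"
  shows
    "(\<exists>(S :: real^('t \<times> 'w)^('t \<times> 'w)) \<sigma> \<tau>. diagonalizes P S \<sigma> \<tau>) \<and>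
     (\<forall>(S :: real^('t \<times> 'w)^('t \<times> 'w)) \<sigma> \<tau>. diagonalizes P S \<sigma> \<tau> \<longrightarrow>
        optimal_value (worst_case P x0 \<gamma>) U =
          optimal_value (\<lambda>z. ereal (R_objective P x0 \<gamma> z)) (R_feasible P x0 U S \<sigma> \<tau>)
          + ereal (2 * (vec_a TYPE('t) P \<bullet> x0) + x0 \<bullet> (bigA TYPE('t) P *v x0)) \<and>
        (\<forall>u. is_arg_min (worst_case P x0 \<gamma>) (\<lambda>u. u \<in> U) u \<longleftrightarrow>
           (\<exists>l t. is_arg_min (R_objective P x0 \<gamma>)
              (\<lambda>z. z \<in> R_feasible P x0 U S \<sigma> \<tau>) (u, l, t)))) \<and>
     (polyhedron U \<or> soc_representable U \<longrightarrow>
        (\<exists>Z p. socp_reformulation (worst_case P x0 \<gamma>) U Z p))"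
proof -
  interpret convex_lq_system P "TYPE('t)"
    using assms(1,2) by unfold_locales
  have "\<exists>Z p. socp_reformulation (worst_case P x0 \<gamma>) U Z p"
    if "polyhedron U \<or> soc_representable U"
    using that exists_socp_reformulation[OF \<open>\<gamma> > 0\<close>] polyhedron_imp_soc_representable by blast
  then show ?thesis
    using exists_diagonalizes worst_case_minimization_via_R(1,2)[OF _ \<open>\<gamma> > 0\<close>] by auto
qed

end
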